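(* Fix integers $2\leqslant k\leqslant n$ and $r>0$, and suppose that every $k$-dimensional convex body $L$ of constant width $2r$ satisfies $$\mathrm{Vol}_k(L)\geqslant\mu_k\kappa_k r^k$$ for some constant $0<\mu_k\leqslant1$. If $K\subset\mathbb{R}^n$ is a convex body of constant width $2r$, then $$\mathcal A_k(K)\leqslant\kappa_n(1-\mu_k)r^k,$$ where $\mathcal A_k(K)=W_{n-k}(C)-W_{n-k}(K)$ and $C=\frac12(K+(-K))$.
   Context: A convex body in $\mathbb{R}^n$ is a compact convex set with non-empty interior; $h_K(u)=\max_{x\in K}\langle x,u\rangle$ is its support function. $K$ has constant width $2r$ if $h_K(u)+h_K(-u)=2r$ for all unit vectors $u$. $B^n$ is the Euclidean unit ball and $\kappa_n=\mathrm{Vol}_n(B^n)$. $V$ is the mixed volume, normalized by $V(K,\ldots,K)=\mathrm{Vol}_n(K)$, and the quermassintegrals are $W_j(K)=V(K^{[n-j]},(B^n)^{[j]})$, where $[r]$ denotes repetition $r$ times. *)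

theory Defs
  imports "HOL-Analysis.Analysis"
begin

text \<open>
  The sum \<open>A + B\<close> of sets is the Minkowski sum of \<^theory>\<open>HOL-Library.Set_Algebras\<close>. Beware that \<open>- A\<close> denotes
  the complement; the reflection of \<open>A\<close> in the origin is \<open>uminus ` A\<close>.
\<close>

definition convex_body :: "'a::euclidean_space set \<Rightarrow> bool" where
  "convex_body K \<longleftrightarrow> compact K \<and> convex K \<and> interior K \<noteq> {}"

definition supp_fun :: "'a::euclidean_space set \<Rightarrow> 'a \<Rightarrow> real" where
  "supp_fun K u = (SUP x\<in>K. x \<bullet> u)"

definition constant_width :: "'a::euclidean_space set \<Rightarrow> real \<Rightarrow> bool" where
  "constant_width K w \<longleftrightarrow> (\<forall>u. norm u = 1 \<longrightarrow> supp_fun K u + supp_fun K (- u) = w)"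

text \<open>
  With \<open>n = DIM('a)\<close>, the following relation expresses Minkowski's expansion
  \[ Vol (t_0 K_0 + \cdots + t_{n-1} K_{n-1})
     = \sum_{i_1,\ldots,i_n < n} c(i_1,\ldots,i_n)\, t_{i_1} \cdots t_{i_n} \qquad (t_0,\ldots,t_{n-1} \ge 0) \]
  with coefficients that are symmetric in their indices; bodies and indices are given as lists, so
  that \<open>replicate r K\<close> is the \<open>r\<close>-fold repetition of \<open>K\<close>. Such coefficients are unique
  (lemma \<open>mixed_coeffs_unique\<close>), and \<open>c(i_1,\<dots>,i_n)\<close> is the mixed volume
  \<open>V(K_{i_1},\<dots>,K_{i_n})\<close>. The factor \<open>1/n!\<close> of the monomial \<open>t_0 \<cdots> t_{n-1}\<close> is accounted for because
  the sum runs over ordered tuples of indices; this is the normalization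
  \<open>V(K,\<dots>,K) = Vol K\<close> (lemma \<open>mixed_volume_replicate\<close>).
\<close>

definition mixed_coeffs :: "'a::euclidean_space set list \<Rightarrow> (nat list \<Rightarrow> real) \<Rightarrow> bool" where
  "mixed_coeffs Ks c \<longleftrightarrow>
     (\<forall>is js. mset is = mset js \<longrightarrow> c is = c js) \<and>
     (\<forall>t. (\<forall>i. 0 \<le> t i) \<longrightarrow>
        measure lebesgue (\<Sum>i<DIM('a). (*\<^sub>R) (t i) ` (Ks ! i)) =
        (\<Sum>is | set is \<subseteq> {..<DIM('a)} \<and> length is = DIM('a). c is * (\<Prod>i\<leftarrow>is. t i)))"

definition mixed_volume :: "'a::euclidean_space set list \<Rightarrow> real" where
  "mixed_volume Ks = (THE v. \<exists>c. mixed_coeffs Ks c \<and> v = c [0..<DIM('a)])"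

definition quermassintegral :: "nat \<Rightarrow> 'a::euclidean_space set \<Rightarrow> real" where
  "quermassintegral j K =
     mixed_volume (replicate (DIM('a) - j) K @ replicate j (cball 0 1))"

definition central_sym :: "'a::euclidean_space set \<Rightarrow> 'a set" where
  "central_sym K = (*\<^sub>R) (1/2) ` (K + uminus ` K)"

definition asym_defect :: "nat \<Rightarrow> 'a::euclidean_space set \<Rightarrow> real" where
  "asym_defect k K =
     quermassintegral (DIM('a) - k) (central_sym K) - quermassintegral (DIM('a) - k) K"

lemma sum_alternating_supersets:
  assumes "finite N" "A \<subseteq> N"
  shows "(\<Sum>S | A \<subseteq> S \<and> S \<subseteq> N. (-1) ^ card S :: real) = (if A = N then (-1) ^ card N else 0)"
proof (cases "A = N")
  case True
  then have "{S. A \<subseteq> S \<and> S \<subseteq> N} = {N}" by auto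
  then show ?thesis using True by simp
next
  case False
  then obtain x where x: "x \<in> N" "x \<notin> A" using assms by auto
  let ?F = "{S. A \<subseteq> S \<and> S \<subseteq> N}" and ?G = "{S. A \<subseteq> S \<and> S \<subseteq> N - {x}}"
  have fG: "finite ?G" using assms(1) by (auto intro: finite_subset[of _ "Pow N"])
  have F: "?F = ?G \<union> insert x ` ?G"
  proof (intro equalityI subsetI)
    fix S assume S: "S \<in> ?F"
    show "S \<in> ?G \<union> insert x ` ?G"
    proof (cases "x \<in> S")
      case True
      then have "S = insert x (S - {x})" by auto
      moreover have "S - {x} \<in> ?G" using S x by auto
      ultimately show ?thesis by blast
    qed (use S in auto)
  qed (use x in auto)
  have "(\<Sum>S\<in>insert x ` ?G. (-1) ^ card S :: real) = (\<Sum>S\<in>?G. (-1) ^ card (insert x S))"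
    using x by (subst sum.reindex) (auto simp: inj_on_def)
  also have "\<dots> = (\<Sum>S\<in>?G. - ((-1) ^ card S))"
  proof (intro sum.cong refl)
    fix S assume "S \<in> ?G"
    moreover from this have "finite S" "x \<notin> S" using assms(1) finite_subset by auto
    ultimately show "(-1) ^ card (insert x S) = (- ((-1) ^ card S) :: real)" by simp
  qed
  finally have "(\<Sum>S\<in>?F. (-1) ^ card S :: real) = 0"
    unfolding F by (subst sum.union_disjoint) (use fG in \<open>auto simp: sum_negf\<close>)
  then show ?thesis using False by simp
qed

lemma mixed_coeffs_unique:
  fixes Ks :: "'a::euclidean_space set list"
  assumes "mixed_coeffs Ks c" "mixed_coeffs Ks c'"
  shows "c [0..<DIM('a)] = c' [0..<DIM('a)]"
proof -
  define N where "N = {..<DIM('a)}"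
  define I where "I = {is. set is \<subseteq> N \<and> length is = DIM('a)}"
  define d where "d is = c is - c' is" for "is"
  define t where "t S i = (if i \<in> S then 1 else 0 :: real)" for S :: "nat set" and i
  have fI: "finite I" unfolding I_def N_def by (rule finite_lists_length_eq) simp
  have fN: "finite N" by (simp add: N_def)
  have prod_t: "(\<Prod>i\<leftarrow>is. t S i) = (if set is \<subseteq> S then 1 else 0)" for "is" S
    by (induction "is") (auto simp: t_def)
  have zero: "(\<Sum>is\<in>I. d is * (\<Prod>i\<leftarrow>is. t S i)) = 0" for S
  proof -
    have nn: "\<forall>i. 0 \<le> t S i" by (simp add: t_def)
    have "(\<Sum>is\<in>I. c is * (\<Prod>i\<leftarrow>is. t S i)) = (\<Sum>is\<in>I. c' is * (\<Prod>i\<leftarrow>is. t S i))"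
      using assms[unfolded mixed_coeffs_def, THEN conjunct2, THEN spec, THEN mp, OF nn]
      by (simp only: I_def N_def)
    then show ?thesis by (simp add: d_def left_diff_distrib sum_subtractf)
  qed
  have d_const: "d is = d [0..<DIM('a)]" if "is \<in> I" "set is = N" for "is"
  proof -
    have "distinct is" using that by (intro card_distinct) (simp add: I_def N_def)
    then have "mset is = mset [0..<DIM('a)]"
      using that set_eq_iff_mset_eq_distinct[of "is" "[0..<DIM('a)]"]
      by (simp add: N_def atLeast0LessThan)
    then have "c is = c [0..<DIM('a)]" "c' is = c' [0..<DIM('a)]"
      using assms unfolding mixed_coeffs_def by blast+
    then show ?thesis by (simp add: d_def)
  qed
  have "0 = (\<Sum>S\<in>Pow N. (-1) ^ card S * (\<Sum>is\<in>I. d is * (\<Prod>i\<leftarrow>is. t S i)))"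
    by (simp add: zero)
  also have "\<dots> = (\<Sum>S\<in>Pow N. \<Sum>is\<in>I. d is * (if set is \<subseteq> S then (-1) ^ card S else 0))"
    unfolding sum_distrib_left by (intro sum.cong refl) (simp add: prod_t)
  also have "\<dots> = (\<Sum>is\<in>I. \<Sum>S\<in>Pow N. d is * (if set is \<subseteq> S then (-1) ^ card S else 0))"
    by (rule sum.swap)
  also have "\<dots> = (\<Sum>is\<in>I. d is * (\<Sum>S\<in>Pow N. if set is \<subseteq> S then (-1) ^ card S else 0))"
    by (simp add: sum_distrib_left)
  also have "\<dots> = (\<Sum>is\<in>I. if set is = N then d [0..<DIM('a)] * (-1) ^ card N else 0)"
  proof (intro sum.cong refl)
    fix "is" assume i: "is \<in> I"
    have "(\<Sum>S\<in>Pow N. if set is \<subseteq> S then (-1) ^ card S else 0 :: real)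
        = (\<Sum>S | set is \<subseteq> S \<and> S \<subseteq> N. (-1) ^ card S)"
      using fN by (subst sum.inter_filter [symmetric]) (simp_all add: Pow_def conj_commute)
    also have "\<dots> = (if set is = N then (-1) ^ card N else 0)"
      using fN i by (intro sum_alternating_supersets) (auto simp: I_def)
    finally show "d is * (\<Sum>S\<in>Pow N. if set is \<subseteq> S then (-1) ^ card S else 0)
        = (if set is = N then d [0..<DIM('a)] * (-1) ^ card N else 0)"
      using d_const[OF i] by auto
  qed
  also have "\<dots> = real (card {is\<in>I. set is = N}) * (d [0..<DIM('a)] * (-1) ^ card N)"
    using fI by (subst sum.inter_filter [symmetric]) simp_all
  finally have "card {is\<in>I. set is = N} = 0 \<or> d [0..<DIM('a)] = 0" by auto
  moreover have "[0..<DIM('a)] \<in> {is\<in>I. set is = N}" by (auto simp: I_def N_def)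
  then have "card {is\<in>I. set is = N} \<noteq> 0" using fI by auto
  ultimately show ?thesis by (simp add: d_def)
qed

lemma mixed_volume_eqI:
  fixes Ks :: "'a::euclidean_space set list"
  assumes "mixed_coeffs Ks c"
  shows "mixed_volume Ks = c [0..<DIM('a)]"
  unfolding mixed_volume_def using assms mixed_coeffs_unique by (blast intro: the_equality)

lemma sum_scaled_convex:
  fixes K :: "'a::euclidean_space set"
  assumes "convex K" "K \<noteq> {}" "finite A" "\<And>i. 0 \<le> t i"
  shows "(\<Sum>i\<in>A. (*\<^sub>R) (t i) ` K) = (*\<^sub>R) (\<Sum>i\<in>A. t i) ` K"
  using assms(3)
proof (induction A rule: finite_induct)
  case empty
  then show ?case using assms(2) by (auto simp: set_zero)
next
  case (insert i A)
  have "(*\<^sub>R) (t i) ` K + (*\<^sub>R) (sum t A) ` K = (*\<^sub>R) (t i + sum t A) ` K"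
  proof (rule set_eqI)
    fix z
    have b: "sum t A \<ge> 0" using assms(4) by (simp add: sum_nonneg)
    show "z \<in> (*\<^sub>R) (t i) ` K + (*\<^sub>R) (sum t A) ` K \<longleftrightarrow> z \<in> (*\<^sub>R) (t i + sum t A) ` K"
    proof
      assume "z \<in> (*\<^sub>R) (t i) ` K + (*\<^sub>R) (sum t A) ` K"
      then obtain x y where xy: "x \<in> K" "y \<in> K" "z = t i *\<^sub>R x + sum t A *\<^sub>R y"
        by (auto simp: set_plus_def)
      show "z \<in> (*\<^sub>R) (t i + sum t A) ` K"
      proof (cases "t i + sum t A = 0")
        case True
        then have "t i = 0" "sum t A = 0" using b assms(4)[of i] by linarith+
        then show ?thesis using xy by auto
      next
        case False
        let ?s = "t i + sum t A"
        have "(t i / ?s) *\<^sub>R x + (sum t A / ?s) *\<^sub>R y \<in> K"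
          using xy b assms(4)[of i] False
          by (intro convexD[OF assms(1)]) (auto simp: add_divide_distrib [symmetric])
        moreover have "z = ?s *\<^sub>R ((t i / ?s) *\<^sub>R x + (sum t A / ?s) *\<^sub>R y)"
          using xy False by (simp add: scaleR_add_right)
        ultimately show ?thesis by blast
      qed
    next
      assume "z \<in> (*\<^sub>R) (t i + sum t A) ` K"
      then show "z \<in> (*\<^sub>R) (t i) ` K + (*\<^sub>R) (sum t A) ` K"
        by (auto simp: scaleR_add_left set_plus_def)
    qed
  qed
  then show ?case using insert by simp
qed

lemma mixed_volume_replicate:
  fixes K :: "'a::euclidean_space set"
  assumes "convex K" "K \<noteq> {}"
  shows "mixed_volume (replicate DIM('a) K) = measure lebesgue K"
proof (rule mixed_volume_eqI)
  have pow: "(\<Sum>is | set is \<subseteq> A \<and> length is = n. \<Prod>i\<leftarrow>is. t i) = (\<Sum>i\<in>A. t i) ^ n"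
    if "finite A" for A and n and t :: "nat \<Rightarrow> real"
  proof (induction n)
    case 0
    have "{is. set is \<subseteq> A \<and> length is = 0} = {[]}" by auto
    then show ?case by simp
  next
    case (Suc n)
    let ?L = "\<lambda>n. {is. set is \<subseteq> A \<and> length is = n}"
    have "?L (Suc n) = (\<lambda>(x, is). x # is) ` (A \<times> ?L n)"
      by (auto simp: length_Suc_conv image_iff)
    then have "(\<Sum>is\<in>?L (Suc n). \<Prod>i\<leftarrow>is. t i) = (\<Sum>(x, is)\<in>A \<times> ?L n. t x * (\<Prod>i\<leftarrow>is. t i))"
      by (simp add: sum.reindex inj_on_def case_prod_unfold)
    also have "\<dots> = (\<Sum>x\<in>A. t x) * (\<Sum>is\<in>?L n. \<Prod>i\<leftarrow>is. t i)"
      by (simp add: sum_product sum.cartesian_product)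
    finally show ?case using Suc by simp
  qed
  show "mixed_coeffs (replicate DIM('a) K) (\<lambda>_. measure lebesgue K)"
    unfolding mixed_coeffs_def
  proof (intro conjI allI impI)
    fix t :: "nat \<Rightarrow> real" assume t: "\<forall>i. 0 \<le> t i"
    have "(\<Sum>i<DIM('a). (*\<^sub>R) (t i) ` (replicate DIM('a) K ! i)) = (\<Sum>i<DIM('a). (*\<^sub>R) (t i) ` K)"
      by (intro sum.cong) auto
    also have "\<dots> = (*\<^sub>R) (\<Sum>i<DIM('a). t i) ` K"
      using t assms by (intro sum_scaled_convex) auto
    also have "measure lebesgue \<dots> = (\<Sum>i<DIM('a). t i) ^ DIM('a) * measure lebesgue K"
      using measure_lebesgue_affine[of "\<Sum>i<DIM('a). t i" 0 K] t by (simp add: sum_nonneg)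
    finally show "measure lebesgue (\<Sum>i<DIM('a). (*\<^sub>R) (t i) ` (replicate DIM('a) K ! i)) =
        (\<Sum>is | set is \<subseteq> {..<DIM('a)} \<and> length is = DIM('a). measure lebesgue K * (\<Prod>i\<leftarrow>is. t i))"
      by (simp add: sum_distrib_left [symmetric] pow)
  qed simp
qed

end

theory Submission
  imports Defs "HOL-Computational_Algebra.Polynomial"
begin

text \<open>
  Kubota's formula would express \<open>W\<^bsub>n-k\<^esub>(K)\<close> as an average of the volumes of the \<open>k\<close>-dimensional
  projections of \<open>K\<close>, which have constant width \<open>2r\<close>, while \<open>C\<close> is the ball of radius \<open>r\<close>. Instead of
  integrating over a Grassmannian, approximate the unit ball \<open>B\<close> by zonotopes \<open>Z = \<Sum>\<^sub>i [0, w\<^sub>i]\<close>. The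
  volume of \<open>K + t Z\<close> is a polynomial \<open>\<Sum>\<^sub>S f\<^sub>K(S) t\<^bsup>card S\<^esup>\<close> over sets \<open>S\<close> of generators; for
  \<open>card S = n - k\<close>, Fubini along the orthogonal complement of the generators in \<open>S\<close> gives
  \<open>\<mu> r\<^sup>k f\<^sub>B(S) \<le> f\<^sub>K(S)\<close>, because both coefficients are the same multiple of the volume of a projection.
  In the limit \<open>Z \<rightarrow> B\<close> this yields both the Steiner polynomial of \<open>K\<close>, hence its mixed volumes with \<open>B\<close>,
  and the inequality \<open>\<mu> r\<^sup>k W\<^bsub>n-k\<^esub>(B) \<le> W\<^bsub>n-k\<^esub>(K)\<close>.
\<close>

section \<open>Rotation invariance of Lebesgue measure\<close>

text \<open>A mixed volume is a definite description, so a quermassintegral has a usable value only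
  after a complete symmetric expansion of the volume has been exhibited. Zonotopes supply one at
  finite level because adding a single segment changes the volume affinely in its length. The number
  of generators is unbounded along the approximation, but comparison with balls keeps all degrees at
  most \<open>n\<close>, and then pointwise convergence on the half line forces convergence of each
  coefficient.

  A single \<open>f S\<close> is accessible as the leading coefficient of the polynomial built from
  the generators in \<open>S\<close> alone. Leading coefficients ignore a bounded enlargement of the
  zonotope. This slack allows two one-sided Fubini estimates, one for \<open>K\<close> and one for
  the ball, in place of an exact formula for the coefficient. The ball also supplies the
  normalization: the volume of \<open>B + t B\<close> is known from the binomial theorem.\<close>

lemma vimage_measure_lborel_orthogonal:
  fixes f :: "'a::euclidean_space \<Rightarrow> 'a"
  assumes f: "orthogonal_transformation f" and B: "B \<in> sets borel"
  shows "emeasure lborel (f -` B) = emeasure lborel B"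
proof -
  \<comment> \<open>The ball \<open>U\<close> is its own preimage under \<open>f\<close> and has
    finite positive measure. One double integral, evaluated in both orders, yields the measure of
    \<open>U\<close> times that of \<open>B\<close> and the measure of \<open>U\<close> times that
    of the preimage of \<open>B\<close>; the factor cancels.\<close>
  define U :: "'a set" where "U = cball 0 1"
  have [measurable]: "B \<in> sets borel" "U \<in> sets borel" using B by (auto simp: U_def)
  have lin: "linear f" using f by (rule orthogonal_transformation_linear)
  have [measurable]: "f \<in> borel_measurable borel"
    using lin by (intro borel_measurable_continuous_onI linear_continuous_on) (simp add: linear_conv_bounded_linear)
  have [measurable]: "f \<in> borel_measurable lborel" by simp
  obtain g where g: "\<And>y. f (g y) = y"
    using orthogonal_transformation_surj[OF f] by (metis surj_def)
  have trans: "(\<integral>\<^sup>+x. h (x + c) \<partial>lborel) = (\<integral>\<^sup>+x. h x \<partial>lborel)"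
    if [measurable]: "h \<in> borel_measurable borel" for h :: "'a \<Rightarrow> ennreal" and c
  proof -
    have "(\<integral>\<^sup>+x. h x \<partial>lborel) = (\<integral>\<^sup>+x. h x \<partial>distr lborel borel ((+) c))"
      by (simp add: lborel_distr_plus)
    also have "\<dots> = (\<integral>\<^sup>+x. h (c + x) \<partial>lborel)" by (rule nn_integral_distr) auto
    finally show ?thesis by (simp add: add.commute)
  qed
  have fU: "f -` U = U" using orthogonal_transformation_norm[OF f] by (auto simp: U_def)
  have U: "(\<integral>\<^sup>+y. indicator U (z - y) \<partial>lborel) = emeasure lborel U" for z
  proof -
    have "(\<integral>\<^sup>+y. indicator U (z - y) \<partial>lborel) = (\<integral>\<^sup>+y. indicator U (y + (-z)) \<partial>lborel)"
      by (intro nn_integral_cong) (auto simp: U_def indicator_def norm_minus_commute)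
    also have "\<dots> = (\<integral>\<^sup>+y. indicator U y \<partial>lborel)" by (rule trans) simp
    finally show ?thesis by simp
  qed
  have "emeasure lborel U * emeasure lborel B
      = (\<integral>\<^sup>+x. indicator U (f x) * emeasure lborel B \<partial>lborel)"
    using fU by (subst nn_integral_multc) (simp_all flip: indicator_vimage)
  also have "\<dots> = (\<integral>\<^sup>+x. indicator U (f x) * (\<integral>\<^sup>+y. indicator B (y + f x) \<partial>lborel) \<partial>lborel)"
    using trans[of "indicator B"] by simp
  also have "\<dots> = (\<integral>\<^sup>+x. (\<integral>\<^sup>+y. indicator U (f x) * indicator B (y + f x) \<partial>lborel) \<partial>lborel)"
    by (intro nn_integral_cong nn_integral_cmult[symmetric]) simp
  also have "\<dots> = (\<integral>\<^sup>+y. (\<integral>\<^sup>+x. indicator U (f x) * indicator B (y + f x) \<partial>lborel) \<partial>lborel)"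
    by (rule lborel_pair.Fubini'[symmetric]) measurable
  also have "\<dots> = (\<integral>\<^sup>+y. (\<integral>\<^sup>+x. indicator U (f x - y) * indicator B (f x) \<partial>lborel) \<partial>lborel)"
  proof (rule nn_integral_cong)
    \<comment> \<open>Shifting \<open>x\<close> by a preimage \<open>g y\<close> of \<open>y\<close>
      moves the translation from \<open>B\<close> to \<open>U\<close>, where the integral over
      \<open>y\<close> no longer depends on \<open>x\<close>.\<close>
    fix y
    have "(\<integral>\<^sup>+x. indicator U (f x) * indicator B (y + f x) \<partial>lborel) =
        (\<integral>\<^sup>+x. indicator U (f (x + g y) - y) * indicator B (f (x + g y)) \<partial>lborel)"
      by (simp add: linear_add[OF lin] g add.commute)
    also have "\<dots> = (\<integral>\<^sup>+x. indicator U (f x - y) * indicator B (f x) \<partial>lborel)"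
      by (rule trans) measurable
    finally show "(\<integral>\<^sup>+x. indicator U (f x) * indicator B (y + f x) \<partial>lborel) =
      (\<integral>\<^sup>+x. indicator U (f x - y) * indicator B (f x) \<partial>lborel)" .
  qed
  also have "\<dots> = (\<integral>\<^sup>+x. (\<integral>\<^sup>+y. indicator U (f x - y) * indicator B (f x) \<partial>lborel) \<partial>lborel)"
    by (rule lborel_pair.Fubini') measurable
  also have "\<dots> = (\<integral>\<^sup>+x. emeasure lborel U * indicator B (f x) \<partial>lborel)"
    by (intro nn_integral_cong) (subst nn_integral_multc, simp_all add: U)
  also have "\<dots> = emeasure lborel U * emeasure lborel (f -` B)"
  proof -
    have [measurable]: "f -` B \<in> sets borel"
      using measurable_sets_borel[of f borel B] by simp
    show ?thesis
      by (subst nn_integral_cmult) (simp_all flip: indicator_vimage)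
  qed
  finally have "emeasure lborel U * emeasure lborel B = emeasure lborel U * emeasure lborel (f -` B)" .
  moreover have "emeasure lborel U \<noteq> 0"
    using emeasure_lborel_cball_finite content_cball_pos[of 1 "0::'a"]
    by (auto simp: U_def measure_def)
  moreover have "emeasure lborel U \<noteq> top"
    using emeasure_lborel_cball_finite[of "0::'a" 1] by (simp add: U_def)
  ultimately show ?thesis by (simp add: ennreal_mult_cancel_left)
qed

lemma distr_lborel_orthogonal:
  fixes f :: "'a::euclidean_space \<Rightarrow> 'a"
  assumes f: "orthogonal_transformation f"
  shows "distr lborel borel f = lborel"
proof (rule measure_eqI)
  have "f \<in> borel_measurable borel"
    using orthogonal_transformation_linear[OF f]
    by (intro borel_measurable_continuous_onI linear_continuous_on) (simp add: linear_conv_bounded_linear)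
  then show "emeasure (distr lborel borel f) A = emeasure lborel A" if "A \<in> sets (distr lborel borel f)" for A
    using that vimage_measure_lborel_orthogonal[OF f, of A] by (simp add: emeasure_distr)
qed simp

section \<open>Volume of sums with zonotopes\<close>

abbreviation vol :: "'a::euclidean_space set \<Rightarrow> real" where
  "vol \<equiv> measure lebesgue"

lemma compact_set_plus:
  fixes A B :: "'a::real_normed_vector set"
  assumes "compact A" "compact B"
  shows "compact (A + B)"
  unfolding set_plus_image using assms
  by (intro compact_continuous_image compact_Times) (auto simp: case_prod_unfold intro!: continuous_intros)

lemma vol_mono:
  assumes "compact A" "compact B" "A \<subseteq> B"
  shows "vol A \<le> vol B"
  using assms by (intro measure_mono_fmeasurable) (auto intro: lmeasurable_compact fmeasurableD)

lemma vol_translate_mono: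
  assumes "compact A" "compact B" "(+) p ` A \<subseteq> B"
  shows "vol A \<le> vol B"
proof -
  have "vol A = vol ((+) p ` A)" by (simp add: measure_translation)
  also have "\<dots> \<le> vol B" using assms by (intro vol_mono) (auto intro: compact_translation)
  finally show ?thesis .
qed

text \<open>Nonnegativity makes \<open>g\<close> monotone. Comparing \<open>g (m * t)\<close> with
  the values at the two integers around \<open>m * t\<close> bounds \<open>m\<close> times the error
  by \<open>g 1\<close> for every \<open>m\<close>, so the error vanishes.\<close>

lemma additive_mono_imp_linear:
  fixes g :: "real \<Rightarrow> real"
  assumes add: "\<And>s t. 0 \<le> s \<Longrightarrow> 0 \<le> t \<Longrightarrow> g (s + t) = g s + g t"
    and nonneg: "\<And>t. 0 \<le> t \<Longrightarrow> 0 \<le> g t" and t: "0 \<le> t"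
  shows "g t = t * g 1"
proof -
  have mono: "g s \<le> g t" if "0 \<le> s" "s \<le> t" for s t
    using add[of s "t - s"] nonneg[of "t - s"] that by simp
  have mult: "g (real m * s) = real m * g s" if "0 \<le> s" for m s
  proof (induction m)
    case 0
    show ?case using add[of 0 0] by simp
  next
    case (Suc m)
    then show ?case using add[of "real m * s" s] that by (simp add: algebra_simps)
  qed
  have bound: "real m * \<bar>g t - t * g 1\<bar> \<le> g 1" for m
  proof -
    define k where "k = nat \<lfloor>real m * t\<rfloor>"
    have k: "real k \<le> real m * t" "real m * t \<le> real k + 1"
      using t unfolding k_def by (simp, linarith?)+
    have "g (real k) = real k * g 1" using mult[of 1 k] by simp
    moreover have "g (real k + 1) = real k * g 1 + g 1" using add[of "real k" 1] mult[of 1 k] by simp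
    moreover have "g (real k) \<le> g (real m * t)" "g (real m * t) \<le> g (real k + 1)"
      using k t by (auto intro: mono)
    moreover have "real k * g 1 \<le> real m * t * g 1" "real m * t * g 1 \<le> (real k + 1) * g 1"
      using k nonneg[of 1] by (auto intro: mult_right_mono)
    ultimately have "\<bar>g (real m * t) - real m * t * g 1\<bar> \<le> g 1"
      by (simp add: algebra_simps abs_le_iff)
    then have "\<bar>real m * (g t - t * g 1)\<bar> \<le> g 1"
      by (simp add: mult[OF t] right_diff_distrib mult.assoc)
    then show ?thesis by (simp add: abs_mult)
  qed
  have "\<bar>g t - t * g 1\<bar> = 0"
  proof (rule ccontr)
    assume "\<bar>g t - t * g 1\<bar> \<noteq> 0"
    then have "0 < \<bar>g t - t * g 1\<bar>" by linarith
    then obtain m where "g 1 < real m * \<bar>g t - t * g 1\<bar>" using reals_Archimedean3 by blast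
    then show False using bound[of m] by simp
  qed
  then show ?thesis by simp
qed

lemma set_plus_segment:
  fixes K :: "'a::real_vector set"
  assumes "0 \<le> t"
  shows "K + closed_segment 0 (t *\<^sub>R v) = {a + s *\<^sub>R v | a s. a \<in> K \<and> 0 \<le> s \<and> s \<le> t}"
proof (intro equalityI subsetI)
  fix x assume "x \<in> K + closed_segment 0 (t *\<^sub>R v)"
  then obtain a u where "a \<in> K" "0 \<le> u" "u \<le> 1" "x = a + (u * t) *\<^sub>R v"
    by (auto simp: set_plus_def closed_segment_def)
  moreover have "0 \<le> u * t" "u * t \<le> t" using calculation assms by (auto simp: mult_left_le_one_le)
  ultimately show "x \<in> {a + s *\<^sub>R v | a s. a \<in> K \<and> 0 \<le> s \<and> s \<le> t}" by blast
next
  fix x assume "x \<in> {a + s *\<^sub>R v | a s. a \<in> K \<and> 0 \<le> s \<and> s \<le> t}"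
  then obtain a s where *: "a \<in> K" "0 \<le> s" "s \<le> t" "x = a + s *\<^sub>R v" by blast
  have "s *\<^sub>R v = (s / t) *\<^sub>R (t *\<^sub>R v)" "0 \<le> s / t" "s / t \<le> 1"
    using * by (auto simp: divide_simps)
  then have "s *\<^sub>R v \<in> closed_segment 0 (t *\<^sub>R v)"
    unfolding closed_segment_def by force
  then show "x \<in> K + closed_segment 0 (t *\<^sub>R v)" using * by auto
qed

text \<open>
  If \<open>K\<^sub>t = K + [0, t v]\<close>, then convexity gives \<open>K\<^sub>s \<inter> (K\<^sub>t + s v) = K + s v\<close>, while
  \<open>K\<^sub>s \<union> (K\<^sub>t + s v) = K\<^bsub>s+t\<^esub>\<close>; so \<open>t \<mapsto> vol K\<^sub>t - vol K\<close> is additive.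
\<close>

lemma vol_plus_segment:
  fixes K :: "'a::euclidean_space set"
  assumes K: "compact K" "convex K" and t: "0 \<le> t"
  shows "vol (K + closed_segment 0 (t *\<^sub>R v)) = vol K + t * (vol (K + closed_segment 0 v) - vol K)"
proof -
  define L where "L t = K + closed_segment 0 (t *\<^sub>R v)" for t
  define g where "g t = vol (L t) - vol K" for t
  have L: "L t = {a + s *\<^sub>R v | a s. a \<in> K \<and> 0 \<le> s \<and> s \<le> t}" if "0 \<le> t" for t
    using set_plus_segment[OF that] by (simp add: L_def)
  have cL: "compact (L t)" for t
    unfolding L_def using K by (intro compact_set_plus) auto
  have "g t = t * g 1"
  proof (rule additive_mono_imp_linear[OF _ _ t])
    fix s t :: real assume s: "0 \<le> s" and t: "0 \<le> t"
    have un: "L (s + t) = L s \<union> (+) (s *\<^sub>R v) ` L t"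
    proof (intro equalityI subsetI)
      fix x assume "x \<in> L (s + t)"
      then obtain a u where *: "a \<in> K" "0 \<le> u" "u \<le> s + t" "x = a + u *\<^sub>R v"
        using L[of "s + t"] s t by auto
      show "x \<in> L s \<union> (+) (s *\<^sub>R v) ` L t"
      proof (cases "u \<le> s")
        case True
        then have "x \<in> L s" using * L[OF s] by blast
        then show ?thesis by simp
      next
        case False
        have "a + (u - s) *\<^sub>R v \<in> L t" using * False L[OF t] by force
        moreover have "x = s *\<^sub>R v + (a + (u - s) *\<^sub>R v)" using * by (simp add: algebra_simps)
        ultimately show ?thesis by blast
      qed
    next
      fix x assume "x \<in> L s \<union> (+) (s *\<^sub>R v) ` L t"
      then show "x \<in> L (s + t)"
      proof
        assume "x \<in> L s"
        then show ?thesis using L[OF s] L[of "s + t"] s t by force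
      next
        assume "x \<in> (+) (s *\<^sub>R v) ` L t"
        then obtain a u where "a \<in> K" "0 \<le> u" "u \<le> t" "x = s *\<^sub>R v + (a + u *\<^sub>R v)"
          using L[OF t] by auto
        moreover from this have "x = a + (s + u) *\<^sub>R v" by (simp add: algebra_simps)
        ultimately show ?thesis using L[of "s + t"] s t
          by (smt (verit, best) mem_Collect_eq)
      qed
    qed
    have int: "L s \<inter> (+) (s *\<^sub>R v) ` L t = (+) (s *\<^sub>R v) ` K"
    proof (intro equalityI subsetI)
      fix x assume "x \<in> L s \<inter> (+) (s *\<^sub>R v) ` L t"
      then have "x \<in> L s" and "x \<in> (+) (s *\<^sub>R v) ` L t" by auto
      obtain a p where a: "a \<in> K" "0 \<le> p" "p \<le> s" "x = a + p *\<^sub>R v"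
        using \<open>x \<in> L s\<close> L[OF s] by auto
      obtain b q where b: "b \<in> K" "0 \<le> q" "q \<le> t" "x = s *\<^sub>R v + (b + q *\<^sub>R v)"
        using \<open>x \<in> (+) (s *\<^sub>R v) ` L t\<close> L[OF t] by auto
      have "x - s *\<^sub>R v \<in> K"
      proof (cases "s - p + q = 0")
        case True
        then have "q = 0" using a b by linarith
        then show ?thesis using b by simp
      next
        case False
        \<comment> \<open>Seen from \<open>x - s v\<close>, the point \<open>a\<close> lies
          \<open>s - p\<close> ahead along \<open>v\<close> and \<open>b\<close> lies
          \<open>q\<close> behind, so \<open>x - s v\<close> is their convex combination with
          weights \<open>q / d\<close> and \<open>(s - p) / d\<close>.\<close>
        define d where "d = s - p + q"
        have d: "d > 0" using False a b unfolding d_def by linarith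
        have "(q / d) *\<^sub>R a + ((s - p) / d) *\<^sub>R b \<in> K"
          using a b d by (intro convexD[OF K(2)]) (auto simp: d_def simp flip: add_divide_distrib)
        moreover have "x - s *\<^sub>R v = (q / d) *\<^sub>R a + ((s - p) / d) *\<^sub>R b"
        proof -
          define y where "y = x - s *\<^sub>R v"
          have ab: "a = y + (s - p) *\<^sub>R v" "b = y - q *\<^sub>R v"
            using a b by (auto simp: y_def algebra_simps)
          have "(q / d) *\<^sub>R a + ((s - p) / d) *\<^sub>R b
             = (q / d + (s - p) / d) *\<^sub>R y + ((q / d) * (s - p) - ((s - p) / d) * q) *\<^sub>R v"
            unfolding ab scaleR_add_right scaleR_diff_right scaleR_add_left scaleR_diff_left scaleR_scaleR
            by (simp add: algebra_simps add_divide_distrib diff_divide_distrib)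
          also have "q / d + (s - p) / d = 1" using d by (simp add: d_def divide_simps)
          finally show ?thesis by (simp add: y_def)
        qed
        ultimately show ?thesis by simp
      qed
      then show "x \<in> (+) (s *\<^sub>R v) ` K" by (rule rev_image_eqI) simp
    next
      fix x assume "x \<in> (+) (s *\<^sub>R v) ` K"
      then obtain a where a: "a \<in> K" "x = a + s *\<^sub>R v" by (auto simp: add.commute)
      then have "x \<in> L s" using L[OF s] s by blast
      moreover have "a \<in> L t" using L[OF t] t a by force
      ultimately show "x \<in> L s \<inter> (+) (s *\<^sub>R v) ` L t" using a by (auto simp: add.commute)
    qed
    have "vol (L (s + t)) = vol (L s) + vol ((+) (s *\<^sub>R v) ` L t) - vol (L s \<inter> (+) (s *\<^sub>R v) ` L t)"
      unfolding un by (rule measure_Un3) (auto intro!: lmeasurable_compact compact_translation cL)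
    then show "g (s + t) = g s + g t"
      by (simp add: int measure_translation g_def)
  next
    fix t :: real assume t: "0 \<le> t"
    have "K \<subseteq> L t" using L[OF t] t by force
    then show "0 \<le> g t" using vol_mono[OF K(1) cL] by (simp add: g_def)
  qed
  then show ?thesis by (simp add: g_def L_def)
qed

text \<open>Segments from 0, instead of symmetric ones, put 0 in every zonotope and make the
  zonotope of fewer generators a subset. The price is that comparisons with balls hold only up to
  translation.\<close>

definition zonotope :: "'i set \<Rightarrow> ('i \<Rightarrow> 'a::real_vector) \<Rightarrow> 'a set" where
  "zonotope I w = (\<Sum>i\<in>I. closed_segment 0 (w i))"

lemma zonotope_empty [simp]: "zonotope {} w = {0}"
  by (simp add: zonotope_def set_zero)

lemma zonotope_insert:
  assumes "finite I" "i \<notin> I"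
  shows "zonotope (insert i I) w = closed_segment 0 (w i) + zonotope I w"
  using assms by (simp add: zonotope_def)

lemma convex_zonotope [simp]: "finite I \<Longrightarrow> convex (zonotope I w)"
  by (induction I rule: finite_induct) (auto simp: zonotope_insert convex_set_plus)

lemma compact_zonotope [simp]:
  fixes w :: "'i \<Rightarrow> 'a::euclidean_space"
  shows "finite I \<Longrightarrow> compact (zonotope I w)"
  by (induction I rule: finite_induct) (auto simp: zonotope_insert compact_set_plus)

lemma zero_in_zonotope [simp]: "finite I \<Longrightarrow> 0 \<in> zonotope I w"
proof (induction I rule: finite_induct)
  case (insert i I)
  then show ?case using set_plus_intro[of 0 "closed_segment 0 (w i)" 0 "zonotope I w"]
    by (simp add: zonotope_insert)
qed simp

lemma zonotope_mono:
  assumes "finite I" "S \<subseteq> I"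
  shows "zonotope S w \<subseteq> zonotope I w"
proof -
  have "zonotope I w = zonotope (I - S) w + zonotope S w"
    using assms by (simp add: zonotope_def sum.subset_diff)
  then show ?thesis using set_zero_plus2[of "zonotope (I - S) w"] assms by simp
qed

lemma scaleR_image_plus:
  "(*\<^sub>R) t ` (A + B) = (*\<^sub>R) t ` A + (*\<^sub>R) t ` (B :: 'a::real_vector set)"
  by (auto simp: set_plus_def image_iff) (metis scaleR_add_right)+

lemma scaleR_zonotope:
  assumes "finite I"
  shows "(*\<^sub>R) t ` zonotope I w = zonotope I (\<lambda>i. t *\<^sub>R w i)"
  using assms
proof (induction I rule: finite_induct)
  case (insert i I)
  have "(*\<^sub>R) t ` closed_segment 0 (w i) = closed_segment 0 (t *\<^sub>R w i)"
    using closed_segment_linear_image[of "(*\<^sub>R) t" 0 "w i"] by (simp add: linear_scaleR)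
  then show ?case using insert by (simp add: zonotope_insert scaleR_image_plus)
qed simp

text \<open>The volume is affine in the weight of the new generator, and its slope is the difference
  of the expansions for \<open>K\<close> plus the full segment and for \<open>K\<close>; hence
  \<open>K\<close> is arbitrary in the induction. Each weight occurs at most to the first power,
  which is why subsets index the monomials.\<close>

lemma vol_plus_zonotope_expansion:
  fixes w :: "'i \<Rightarrow> 'a::euclidean_space"
  assumes "finite I" "compact K" "convex K"
  shows "\<exists>f. \<forall>t. (\<forall>i\<in>I. 0 \<le> t i) \<longrightarrow>
     vol (K + zonotope I (\<lambda>i. t i *\<^sub>R w i)) = (\<Sum>S\<in>Pow I. f S * (\<Prod>i\<in>S. t i))"
  using assms
proof (induction I arbitrary: K rule: finite_induct)
  case empty
  then show ?case by (auto intro: exI[of _ "\<lambda>_. vol K"])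
next
  case (insert i I)
  let ?s = "closed_segment 0 (w i)"
  from insert.IH[OF insert.prems] obtain f where
    f: "\<And>t. (\<forall>i\<in>I. 0 \<le> t i) \<Longrightarrow> vol (K + zonotope I (\<lambda>i. t i *\<^sub>R w i)) = (\<Sum>S\<in>Pow I. f S * (\<Prod>i\<in>S. t i))"
    by blast
  have "compact (K + ?s)" "convex (K + ?s)"
    using insert.prems by (auto intro: compact_set_plus convex_set_plus)
  from insert.IH[OF this] obtain f' where
    f': "\<And>t. (\<forall>i\<in>I. 0 \<le> t i) \<Longrightarrow> vol (K + ?s + zonotope I (\<lambda>i. t i *\<^sub>R w i)) = (\<Sum>S\<in>Pow I. f' S * (\<Prod>i\<in>S. t i))"
    by blast
  define h where "h S = (if i \<in> S then f' (S - {i}) - f (S - {i}) else f S)" for S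
  show ?case
  proof (intro exI[of _ h] allI impI)
    fix t :: "'i \<Rightarrow> real" assume t: "\<forall>j\<in>insert i I. 0 \<le> t j"
    let ?Z = "zonotope I (\<lambda>i. t i *\<^sub>R w i)"
    have inj: "inj_on (insert i) (Pow I)" using insert.hyps by (auto simp: inj_on_def)
    have dis: "Pow I \<inter> insert i ` Pow I = {}" using insert.hyps by auto
    have "K + zonotope (insert i I) (\<lambda>i. t i *\<^sub>R w i) = (K + ?Z) + closed_segment 0 (t i *\<^sub>R w i)"
      using insert.hyps by (simp add: zonotope_insert ac_simps)
    also have "vol \<dots> = vol (K + ?Z) + t i * (vol ((K + ?Z) + ?s) - vol (K + ?Z))"
      using insert.prems insert.hyps t by (intro vol_plus_segment) (auto intro: compact_set_plus convex_set_plus)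
    also have "(K + ?Z) + ?s = K + ?s + ?Z" by (simp add: ac_simps)
    also have "vol (K + ?Z) + t i * (vol (K + ?s + ?Z) - vol (K + ?Z)) =
      (\<Sum>S\<in>Pow I. f S * (\<Prod>i\<in>S. t i)) + (\<Sum>S\<in>Pow I. (f' S - f S) * (t i * (\<Prod>i\<in>S. t i)))"
    proof -
      have "\<forall>i\<in>I. 0 \<le> t i" using t by simp
      then show ?thesis unfolding f[OF \<open>\<forall>i\<in>I. 0 \<le> t i\<close>] f'[OF \<open>\<forall>i\<in>I. 0 \<le> t i\<close>]
        by (simp add: sum_distrib_left sum_subtractf algebra_simps)
    qed
    also have "(\<Sum>S\<in>Pow I. f S * (\<Prod>i\<in>S. t i)) = (\<Sum>S\<in>Pow I. h S * (\<Prod>i\<in>S. t i))"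
      using insert.hyps by (intro sum.cong) (auto simp: h_def)
    also have "(\<Sum>S\<in>Pow I. (f' S - f S) * (t i * (\<Prod>i\<in>S. t i)))
        = (\<Sum>S\<in>insert i ` Pow I. h S * (\<Prod>i\<in>S. t i))"
      unfolding sum.reindex[OF inj]
    proof (intro sum.cong refl)
      fix S assume "S \<in> Pow I"
      then have "finite S" "i \<notin> S" using insert.hyps finite_subset by auto
      then show "(f' S - f S) * (t i * (\<Prod>i\<in>S. t i)) = ((\<lambda>S. h S * (\<Prod>i\<in>S. t i)) \<circ> insert i) S"
        by (simp add: h_def)
    qed
    also have "(\<Sum>S\<in>Pow I. h S * (\<Prod>i\<in>S. t i)) + (\<Sum>S\<in>insert i ` Pow I. h S * (\<Prod>i\<in>S. t i))
       = (\<Sum>S\<in>Pow (insert i I). h S * (\<Prod>i\<in>S. t i))"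
      unfolding Pow_insert using insert.hyps dis by (intro sum.union_disjoint[symmetric]) auto
    finally show "vol (K + zonotope (insert i I) (\<lambda>i. t i *\<^sub>R w i)) =
      (\<Sum>S\<in>Pow (insert i I). h S * (\<Prod>i\<in>S. t i))" .
  qed
qed

text \<open>This is the expansion with weight \<open>t\<close> on the generators in \<open>S\<close>
  and 0 on all others.\<close>

definition subset_poly :: "('i set \<Rightarrow> real) \<Rightarrow> 'i set \<Rightarrow> real poly" where
  "subset_poly f S = (\<Sum>T\<in>Pow S. monom (f T) (card T))"

text \<open>Weight 0 removes a generator, so one \<open>f\<close> serves all subsets at once. Each
  summand \<open>f T\<close> of a coefficient for \<open>I\<close> is therefore itself the leading
  coefficient for a smaller zonotope.\<close>

lemma vol_plus_zonotope_poly: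
  fixes w :: "'i \<Rightarrow> 'a::euclidean_space"
  assumes I: "finite I" and K: "compact K" "convex K"
  shows "\<exists>f. \<forall>S\<subseteq>I. \<forall>t\<ge>0. vol (K + (*\<^sub>R) t ` zonotope S w) = poly (subset_poly f S) t"
proof -
  obtain f where f: "\<And>t. (\<forall>i\<in>I. 0 \<le> t i) \<Longrightarrow>
     vol (K + zonotope I (\<lambda>i. t i *\<^sub>R w i)) = (\<Sum>S\<in>Pow I. f S * (\<Prod>i\<in>S. t i))"
    using vol_plus_zonotope_expansion[OF assms] by blast
  show ?thesis
  proof (intro exI[of _ f] allI impI)
    fix S and t :: real assume S: "S \<subseteq> I" and t: "0 \<le> t"
    define u where "u i = (if i \<in> S then t else 0)" for i
    have fS: "finite S" using S I finite_subset by blast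
    have "zonotope I (\<lambda>i. u i *\<^sub>R w i) = zonotope S (\<lambda>i. t *\<^sub>R w i)"
      unfolding zonotope_def
      using S I by (intro sum.mono_neutral_cong_right) (auto simp: u_def set_zero)
    also have "\<dots> = (*\<^sub>R) t ` zonotope S w" using fS by (simp add: scaleR_zonotope)
    finally have "vol (K + (*\<^sub>R) t ` zonotope S w) = (\<Sum>T\<in>Pow I. f T * (\<Prod>i\<in>T. u i))"
      using f[of u] t by (simp add: u_def)
    also have "\<dots> = (\<Sum>T\<in>Pow S. f T * t ^ card T)"
    proof (intro sum.mono_neutral_cong_right)
      show "\<forall>T\<in>Pow I - Pow S. f T * (\<Prod>i\<in>T. u i) = 0"
      proof
        fix T assume "T \<in> Pow I - Pow S"
        then have "\<exists>i\<in>T. u i = 0" "finite T" using I finite_subset by (auto simp: u_def)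
        then show "f T * (\<Prod>i\<in>T. u i) = 0" by (simp add: prod_zero)
      qed
      fix T assume "T \<in> Pow S"
      then have "(\<Prod>i\<in>T. u i) = (\<Prod>i\<in>T. t)" by (intro prod.cong) (auto simp: u_def)
      then show "f T * (\<Prod>i\<in>T. u i) = f T * t ^ card T" by simp
    qed (use I S in auto)
    finally show "vol (K + (*\<^sub>R) t ` zonotope S w) = poly (subset_poly f S) t"
      by (simp add: subset_poly_def poly_sum poly_monom)
  qed
qed

section \<open>Reading off coefficients from growth\<close>

lemma coeff_subset_poly:
  assumes "finite S"
  shows "coeff (subset_poly f S) j = (\<Sum>T | T \<subseteq> S \<and> card T = j. f T)"
proof -
  have "coeff (subset_poly f S) j = (\<Sum>T\<in>Pow S. if card T = j then f T else 0)"
    by (simp add: subset_poly_def coeff_sum)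
  also have "\<dots> = (\<Sum>T\<in>{T\<in>Pow S. card T = j}. f T)"
    using assms by (simp add: sum.inter_filter[symmetric])
  finally show ?thesis by (simp add: Pow_def)
qed

lemma lead_coeff_subset_poly:
  assumes "finite S"
  shows "coeff (subset_poly f S) (card S) = f S"
proof -
  have "{T. T \<subseteq> S \<and> card T = card S} = {S}" using assms card_subset_eq by auto
  then show ?thesis by (simp add: coeff_subset_poly[OF assms])
qed

lemma degree_subset_poly:
  assumes "finite S"
  shows "degree (subset_poly f S) \<le> card S"
  unfolding subset_poly_def
proof (rule degree_sum_le)
  fix T assume "T \<in> Pow S"
  then have "card T \<le> card S" using assms by (simp add: card_mono)
  then show "degree (monom (f T) (card T)) \<le> card S" using degree_monom_le order_trans by blast
qed (simp add: assms)

text \<open>A positive coefficient of \<open>p - q\<close> at the degree bound would be its leading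
  one and make the difference eventually positive. Inequalities between volumes are passed to
  coefficients in this way.\<close>

lemma coeff_le_of_poly_le:
  fixes p q :: "real poly"
  assumes le: "\<And>t. 0 \<le> t \<Longrightarrow> poly p t \<le> poly q t" and "degree p \<le> d" "degree q \<le> d"
  shows "coeff p d \<le> coeff q d"
proof (rule ccontr)
  assume *: "\<not> coeff p d \<le> coeff q d"
  define r where "r = p - q"
  have "coeff r d > 0" using * by (simp add: r_def)
  moreover have "degree r \<le> d" using assms by (simp add: r_def degree_diff_le)
  ultimately have "lead_coeff r > 0" using le_degree[of r d] by fastforce
  then obtain n where n: "\<And>x. x \<ge> n \<Longrightarrow> poly r x \<ge> lead_coeff r"
    using poly_pinfty_gt_lc by blast
  have "poly r (max n 0) > 0" using n[of "max n 0"] \<open>lead_coeff r > 0\<close> by simp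
  then show False using le[of "max n 0"] by (simp add: r_def)
qed

section \<open>Zonotopes approximating the ball\<close>

text \<open>Comparison of support functions by separating a point from \<open>B\<close>. It places
  balls inside zonotopes and inside the symmetrization of a body.\<close>

lemma subset_if_supports_le:
  fixes A B :: "'a::euclidean_space set"
  assumes "convex B" "closed B" "B \<noteq> {}"
    and le: "\<And>x u. x \<in> A \<Longrightarrow> norm u = 1 \<Longrightarrow> \<exists>y\<in>B. x \<bullet> u \<le> y \<bullet> u"
  shows "A \<subseteq> B"
proof (rule ccontr)
  assume "\<not> A \<subseteq> B"
  then obtain x where x: "x \<in> A" "x \<notin> B" by blast
  obtain a b where ab: "a \<bullet> x < b" "\<And>y. y \<in> B \<Longrightarrow> a \<bullet> y > b"
    using separating_hyperplane_closed_point[OF assms(1,2) x(2)] by blast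
  have "a \<noteq> 0" using ab assms(3) by fastforce
  define u where "u = - (a /\<^sub>R norm a)"
  have "norm u = 1" using \<open>a \<noteq> 0\<close> by (simp add: u_def)
  then obtain y where y: "y \<in> B" "x \<bullet> u \<le> y \<bullet> u" using le[OF x(1)] by blast
  have "a \<bullet> y \<le> a \<bullet> x"
    using y(2) \<open>a \<noteq> 0\<close> by (simp add: u_def inner_commute divide_simps)
  then show False using ab y(1) by fastforce
qed

text \<open>The witness is the reflection in the hyperplane orthogonal to \<open>a - b\<close>; for
  \<open>a = b\<close> it degenerates to the identity.\<close>

lemma orthogonal_transformation_mapping:
  fixes a b :: "'a::euclidean_space"
  assumes "norm a = norm b"
  obtains f where "orthogonal_transformation f" "f a = b"
proof
  define d where "d = a - b"
  define f where "f x = x - (2 * (x \<bullet> d) / (d \<bullet> d)) *\<^sub>R d" for x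
  have "linear f"
    by (rule linearI) (auto simp: f_def algebra_simps add_divide_distrib inner_add_left)
  moreover have "f v \<bullet> f w = v \<bullet> w" for v w
    by (cases "d = 0") (simp_all add: f_def inner_diff_left inner_diff_right divide_simps inner_commute)
  ultimately show "orthogonal_transformation f"
    by (simp add: orthogonal_transformation_def)
  show "f a = b"
  proof (cases "d = 0")
    case True
    then show ?thesis by (simp add: f_def d_def)
  next
    case False
    have "a \<bullet> a = b \<bullet> b" using assms by (simp add: norm_eq)
    then have "2 * (a \<bullet> d) = d \<bullet> d" by (simp add: d_def inner_diff_left inner_diff_right inner_commute)
    then show ?thesis using False by (simp add: f_def d_def)
  qed
qed

lemma zonotope_inner_le:
  assumes "finite I" "z \<in> zonotope I w"
  shows "z \<bullet> u \<le> (\<Sum>i\<in>I. max 0 (w i \<bullet> u))"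
  using assms
proof (induction I arbitrary: z rule: finite_induct)
  case (insert i I)
  then obtain s z' where s: "0 \<le> s" "s \<le> 1" "z' \<in> zonotope I w" "z = s *\<^sub>R w i + z'"
    by (auto simp: zonotope_insert set_plus_def closed_segment_def)
  have "s * (w i \<bullet> u) \<le> s * max 0 (w i \<bullet> u)" using s by (intro mult_left_mono) auto
  also have "\<dots> \<le> max 0 (w i \<bullet> u)" using s by (intro mult_left_le_one_le) auto
  finally have "s * (w i \<bullet> u) \<le> max 0 (w i \<bullet> u)" .
  then show ?case using insert.IH[OF s(3)] insert.hyps s by (simp add: inner_add_left)
qed simp

text \<open>Every segment contributes its better endpoint. With \<open>zonotope_inner_le\<close>
  this computes the support function of a zonotope.\<close>

lemma zonotope_inner_attained:
  assumes "finite I"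
  shows "\<exists>z\<in>zonotope I w. z \<bullet> u = (\<Sum>i\<in>I. max 0 (w i \<bullet> u))"
  using assms
proof (induction I rule: finite_induct)
  case (insert i I)
  then obtain z where z: "z \<in> zonotope I w" "z \<bullet> u = (\<Sum>i\<in>I. max 0 (w i \<bullet> u))" by blast
  define y where "y = (if w i \<bullet> u \<ge> 0 then w i else 0)"
  have "y \<in> closed_segment 0 (w i)" "y \<bullet> u = max 0 (w i \<bullet> u)" by (auto simp: y_def)
  then show ?case using z insert.hyps
    by (intro bexI[of _ "y + z"]) (auto simp: zonotope_insert inner_add_left)
qed simp

text \<open>
  The zonotope is a Riemann sum for \<open>u \<mapsto> \<integral>\<^bsub>B\<^esub> \<bar>x \<bullet> u\<bar> dx\<close>, which by rotation invariance is a positive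
  multiple of the support function of the ball.
\<close>

lemma zonotope_approximates_ball:
  assumes "0 < e"
  shows "\<exists>N (w :: nat \<Rightarrow> 'a::euclidean_space) p. (+) p ` zonotope {..<N} w \<subseteq> cball 0 (1 + e) \<and>
           cball 0 (1 - e) \<subseteq> (+) p ` zonotope {..<N} w"
proof -
  define U :: "'a set" where "U = cball 0 1"
  define F where "F u = (LINT x:U|lborel. \<bar>x \<bullet> u\<bar>)" for u
  have U: "compact U" "U \<in> sets borel" by (auto simp: U_def)
  have int: "set_integrable lborel U (\<lambda>x. \<bar>x \<bullet> u\<bar>)" for u
    unfolding set_integrable_def using U
    by (intro borel_integrable_compact) (auto intro!: continuous_intros)
  have F_cong: "F a = F b" if ab: "norm a = norm b" for a b
  proof -
    obtain T where T: "orthogonal_transformation T" "T a = b"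
      using orthogonal_transformation_mapping[OF ab] .
    have [measurable]: "T \<in> borel_measurable borel"
      using orthogonal_transformation_linear[OF T(1)]
      by (intro borel_measurable_continuous_onI linear_continuous_on) (simp add: linear_conv_bounded_linear)
    have "F b = (LINT x|distr lborel borel T. indicator U x *\<^sub>R \<bar>x \<bullet> b\<bar>)"
      by (simp add: F_def set_lebesgue_integral_def distr_lborel_orthogonal[OF T(1)])
    also have "\<dots> = (LINT x|lborel. indicator U (T x) *\<^sub>R \<bar>T x \<bullet> b\<bar>)"
      using U by (intro integral_distr) auto
    also have "\<dots> = (LINT x|lborel. indicator U x *\<^sub>R \<bar>x \<bullet> a\<bar>)"
      using T orthogonal_transformation_norm[OF T(1)]
      by (intro Bochner_Integration.integral_cong refl)
         (auto simp: U_def indicator_def orthogonal_transformation_def)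
    finally show ?thesis by (simp add: F_def set_lebesgue_integral_def)
  qed
  obtain e0 :: 'a where e0: "norm e0 = 1" using vector_choose_size[of 1] by auto
  define c where "c = F e0"
  have F: "F u = c" if "norm u = 1" for u using F_cong[of u e0] that e0 by (simp add: c_def)
  have "c > 0"
  proof -
    \<comment> \<open>On this ball, which lies in \<open>U\<close>, the first-order term is at least
      1/4: the centre contributes 1/2 and the radius removes at most 1/4. Hence \<open>c\<close> is
      at least a quarter of the volume of \<open>D\<close>.\<close>
    define D where "D = cball ((1/2) *\<^sub>R e0) (1/4)"
    have D: "D \<subseteq> U" 
    proof
      fix x assume "x \<in> D"
      then have "norm (x - (1/2) *\<^sub>R e0) \<le> 1/4" by (simp add: D_def dist_norm norm_minus_commute)
      then show "x \<in> U" using norm_triangle_ineq[of "x - (1/2) *\<^sub>R e0" "(1/2) *\<^sub>R e0"] e0 by (simp add: U_def)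
    qed
    have ge: "1/4 \<le> \<bar>x \<bullet> e0\<bar>" if "x \<in> D" for x
    proof -
      have "\<bar>(x - (1/2) *\<^sub>R e0) \<bullet> e0\<bar> \<le> 1/4"
        using Cauchy_Schwarz_ineq2[of "x - (1/2) *\<^sub>R e0" e0] that e0
        by (simp add: D_def dist_norm norm_minus_commute)
      moreover have "e0 \<bullet> e0 = 1" using e0 by (simp add: norm_eq_1)
      ultimately show ?thesis by (auto simp: inner_diff_left abs_if split: if_splits)
    qed
    have Ds: "D \<in> sets lborel" "emeasure lborel D < \<infinity>"
      using emeasure_lborel_cball_finite[of "(1/2) *\<^sub>R e0" "1/4"] by (simp_all add: D_def)
    have "(LINT x:D|lborel. 1/4) \<le> (LINT x:D|lborel. \<bar>x \<bullet> e0\<bar>)"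
    proof (rule set_integral_mono)
      show "set_integrable lborel D (\<lambda>x. 1/4 :: real)" using Ds by (auto simp: set_integrable_def)
      show "set_integrable lborel D (\<lambda>x. \<bar>x \<bullet> e0\<bar>)" using int Ds(1) D by (rule set_integrable_subset)
    qed (use ge in auto)
    also have "\<dots> \<le> F e0" unfolding F_def set_lebesgue_integral_def
    proof (rule integral_mono)
      show "integrable lborel (\<lambda>x. indicat_real D x *\<^sub>R \<bar>x \<bullet> e0\<bar>)"
        using set_integrable_subset[OF int Ds(1) D] by (simp add: set_integrable_def)
      show "integrable lborel (\<lambda>x. indicat_real U x *\<^sub>R \<bar>x \<bullet> e0\<bar>)"
        using int by (simp add: set_integrable_def)
    qed (use D in \<open>auto simp: indicator_def\<close>)
    finally have "measure lborel D * (1/4) \<le> c"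
      using Ds by (subst (asm) set_integral_const) (auto simp: c_def)
    moreover have "measure lborel D > 0" by (simp add: D_def content_cball_pos)
    ultimately show ?thesis by simp
  qed
  \<comment> \<open>The total error of the Riemann sum is at most the volume of \<open>U\<close>
    times the mesh \<open>d\<close>, that is \<open>e * c\<close>; dividing by \<open>c\<close> in
    the generators leaves \<open>e\<close>.\<close>
  define d where "d = e * c / measure lborel U"
  have mU: "measure lborel U > 0" by (simp add: U_def content_cball_pos)
  have d: "d > 0" using assms \<open>c > 0\<close> mU by (simp add: d_def)
  have "U \<subseteq> (\<Union>x\<in>U. ball x d)" using d by auto
  then obtain X where X: "X \<subseteq> U" "finite X" "U \<subseteq> (\<Union>x\<in>X. ball x d)"
    using compactE_image[OF U(1), of U "\<lambda>x. ball x d"] by auto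
  obtain x N where x: "X = x ` {i::nat. i < N}"
    using finite_imp_nat_seg_image_inj_on[OF X(2)] by blast
  \<comment> \<open>The cells partition \<open>U\<close>, and cell \<open>i\<close> stays within
    \<open>d\<close> of the sample point \<open>x i\<close>.\<close>
  define A where "A i = U \<inter> disjointed (\<lambda>i. ball (x i) d) i" for i
  have A_sets: "A i \<in> sets lborel" for i
    unfolding A_def disjointed_def using U by auto
  have A_disj: "disjoint_family_on A {..<N}"
    using disjoint_family_disjointed[of "\<lambda>i. ball (x i) d"]
    by (auto simp: disjoint_family_on_def A_def)
  have A_Un: "(\<Union>i<N. A i) = U"
    using X x finite_UN_disjointed_eq[of "\<lambda>i. ball (x i) d" N]
    by (auto simp: A_def atLeast0LessThan)
  have A_sub: "A i \<subseteq> U" for i by (auto simp: A_def)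
  have A_fin: "emeasure lborel (A i) < \<infinity>" for i
    using emeasure_mono[OF A_sub[of i], of lborel] U(2) emeasure_compact_finite[OF U(1)]
    by (simp add: order_le_less_trans)
  have A_dist: "norm (y - x i) \<le> d" if "y \<in> A i" for y i
    using that by (auto simp: A_def disjointed_def dist_norm norm_minus_commute)
  define m where "m i = measure lborel (A i)" for i
  have int_A: "set_integrable lborel (A i) (\<lambda>y. \<bar>y \<bullet> u\<bar>)" for i u
    using int A_sets A_sub by (rule set_integrable_subset)
  have int_const: "set_integrable lborel (A i) (\<lambda>y. r)" for i and r :: real
    using A_sets A_fin by (auto simp: set_integrable_def)
  have sum_m: "(\<Sum>i<N. m i) = measure lborel U"
    unfolding m_def A_Un[symmetric] using A_sets A_disj A_fin
    by (intro measure_finite_Union[symmetric]) (auto simp: less_top image_subset_iff)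
  define a where "a i = (m i / c) *\<^sub>R x i" for i
  have approx: "\<bar>(\<Sum>i<N. \<bar>a i \<bullet> u\<bar>) - 1\<bar> \<le> e" if u: "norm u = 1" for u
  proof -
    have near: "\<bar>\<bar>y \<bullet> u\<bar> - \<bar>x i \<bullet> u\<bar>\<bar> \<le> d" if "y \<in> A i" for y i
    proof -
      have "\<bar>y \<bullet> u - x i \<bullet> u\<bar> \<le> norm (y - x i) * norm u"
        using Cauchy_Schwarz_ineq2[of "y - x i" u] by (simp add: inner_diff_left)
      then show ?thesis using A_dist[OF that] u by simp
    qed
    have "c = (\<Sum>i<N. LINT y:A i|lborel. \<bar>y \<bullet> u\<bar>)"
      unfolding F[OF u, symmetric] F_def A_Un[symmetric]
      using A_disj int_A A_sets by (intro set_integral_finite_Union) auto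
    then have c: "c - (\<Sum>i<N. m i * \<bar>x i \<bullet> u\<bar>) = (\<Sum>i<N. (LINT y:A i|lborel. \<bar>y \<bullet> u\<bar>) - m i * \<bar>x i \<bullet> u\<bar>)"
      by (simp add: sum_subtractf)
    have "\<bar>(LINT y:A i|lborel. \<bar>y \<bullet> u\<bar>) - m i * \<bar>x i \<bullet> u\<bar>\<bar> \<le> m i * d" for i
    proof -
      have "(LINT y:A i|lborel. \<bar>y \<bullet> u\<bar>) \<le> (LINT y:A i|lborel. \<bar>x i \<bullet> u\<bar> + d)"
        using near by (intro set_integral_mono int_A int_const) (fastforce simp: abs_le_iff)
      moreover have "(LINT y:A i|lborel. \<bar>x i \<bullet> u\<bar> - d) \<le> (LINT y:A i|lborel. \<bar>y \<bullet> u\<bar>)"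
        using near by (intro set_integral_mono int_A int_const) (fastforce simp: abs_le_iff)
      moreover have "(LINT y:A i|lborel. r) = m i * r" for r
        using A_sets A_fin[of i] by (subst set_integral_const) (auto simp: m_def)
      ultimately show ?thesis by (simp add: algebra_simps abs_le_iff)
    qed
    then have "\<bar>c - (\<Sum>i<N. m i * \<bar>x i \<bullet> u\<bar>)\<bar> \<le> (\<Sum>i<N. m i * d)"
      unfolding c by (intro order_trans[OF sum_abs] sum_mono) auto
    also have "\<dots> = measure lborel U * d" unfolding sum_m[symmetric] by (simp add: sum_distrib_right)
    also have "\<dots> = e * c" using mU by (simp add: d_def)
    finally have *: "\<bar>c - (\<Sum>i<N. m i * \<bar>x i \<bullet> u\<bar>)\<bar> \<le> e * c" .
    have "(\<Sum>i<N. \<bar>a i \<bullet> u\<bar>) = (\<Sum>i<N. m i * \<bar>x i \<bullet> u\<bar>) / c"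
      using \<open>c > 0\<close> by (simp add: a_def abs_mult sum_divide_distrib m_def)
    then have "c * ((\<Sum>i<N. \<bar>a i \<bullet> u\<bar>) - 1) = - (c - (\<Sum>i<N. m i * \<bar>x i \<bullet> u\<bar>))"
      using \<open>c > 0\<close> by (simp add: field_simps)
    then have "\<bar>c * ((\<Sum>i<N. \<bar>a i \<bullet> u\<bar>) - 1)\<bar> \<le> c * e"
      using * by (simp only: abs_minus_cancel mult.commute)
    then show ?thesis using \<open>c > 0\<close> by (simp add: abs_mult)
  qed
  \<comment> \<open>Translating the sum of the segments from 0 to \<open>2 a i\<close> by
    \<open>p\<close> centres it, so that its support function becomes the sum of the absolute values
    of \<open>a i \<bullet> u\<close>.\<close>
  define w where "w i = 2 *\<^sub>R a i" for i
  define p where "p = - (\<Sum>i<N. a i)"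
  have supp: "p \<bullet> u + (\<Sum>i<N. max 0 (w i \<bullet> u)) = (\<Sum>i<N. \<bar>a i \<bullet> u\<bar>)" for u
  proof -
    have "p \<bullet> u + (\<Sum>i<N. max 0 (w i \<bullet> u)) = (\<Sum>i<N. max 0 (w i \<bullet> u) - a i \<bullet> u)"
      by (simp add: p_def inner_sum_left sum_subtractf)
    also have "\<dots> = (\<Sum>i<N. \<bar>a i \<bullet> u\<bar>)"
      by (intro sum.cong refl) (auto simp: w_def max_def abs_if)
    finally show ?thesis .
  qed
  let ?Z = "zonotope {..<N} w"
  have "(+) p ` ?Z \<subseteq> cball 0 (1 + e)"
  proof
    fix z assume "z \<in> (+) p ` ?Z"
    then obtain y where y: "y \<in> ?Z" "z = p + y" by blast
    show "z \<in> cball 0 (1 + e)"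
    proof (cases "z = 0")
      case False
      define u where "u = z /\<^sub>R norm z"
      have u: "norm u = 1" using False by (simp add: u_def)
      have "norm z = z \<bullet> u" using False by (simp add: u_def dot_square_norm power2_eq_square)
      also have "\<dots> \<le> (\<Sum>i<N. \<bar>a i \<bullet> u\<bar>)"
        using zonotope_inner_le[of "{..<N}" y w u] y supp[of u] by (simp add: inner_add_left)
      also have "\<dots> \<le> 1 + e" using approx[OF u] by linarith
      finally show ?thesis by simp
    qed (use assms in simp)
  qed
  moreover have "cball 0 (1 - e) \<subseteq> (+) p ` ?Z"
  proof (rule subset_if_supports_le)
    show "closed ((+) p ` ?Z)" by (intro compact_imp_closed compact_translation) simp
    show "convex ((+) p ` ?Z)" by (intro convex_translation) simp
    show "(+) p ` ?Z \<noteq> {}" using zero_in_zonotope[of "{..<N}" w] by blast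
    fix y u :: 'a assume y: "y \<in> cball 0 (1 - e)" and u: "norm u = 1"
    obtain z where z: "z \<in> ?Z" "z \<bullet> u = (\<Sum>i<N. max 0 (w i \<bullet> u))"
      using zonotope_inner_attained[of "{..<N}" w u] by auto
    have "y \<bullet> u \<le> 1 - e" using norm_cauchy_schwarz[of y u] y u by simp
    also have "\<dots> \<le> (p + z) \<bullet> u"
      using approx[OF u] supp[of u] z by (simp add: inner_add_left)
    finally show "\<exists>z\<in>(+) p ` ?Z. y \<bullet> u \<le> z \<bullet> u" using z by blast
  qed
  ultimately show ?thesis by blast
qed

section \<open>Polynomials and passage to the limit\<close>

text \<open>The nodes are 0, ..., \<open>n\<close>, all in the half line where the volume
  polynomials are known.\<close>

definition lagrange_basis :: "nat \<Rightarrow> nat \<Rightarrow> real poly" where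
  "lagrange_basis n i =
     (\<Prod>j\<in>{..n} - {i}. smult (1 / (real i - real j)) [:- real j, 1:])"

lemma poly_lagrange_basis:
  assumes "i \<le> n" "k \<le> n"
  shows "poly (lagrange_basis n i) (real k) = (if k = i then 1 else 0)"
proof -
  have "poly (lagrange_basis n i) (real k) = (\<Prod>j\<in>{..n} - {i}. (real k - real j) / (real i - real j))"
    by (simp add: lagrange_basis_def poly_prod diff_divide_distrib)
  also have "\<dots> = (if k = i then 1 else 0)"
    using assms by (auto simp: prod_zero_iff)
  finally show ?thesis .
qed

lemma degree_lagrange_basis:
  assumes "i \<le> n"
  shows "degree (lagrange_basis n i) \<le> n"
proof -
  have "degree (lagrange_basis n i)
      \<le> (\<Sum>j\<in>{..n} - {i}. degree (smult (1 / (real i - real j)) [:- real j, 1:]))"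
    unfolding lagrange_basis_def
    using degree_prod_sum_le[of "{..n} - {i}" "\<lambda>j. smult (1 / (real i - real j)) [:- real j, 1:]"]
    by (simp add: o_def)
  also have "\<dots> \<le> (\<Sum>j\<in>{..n} - {i}. 1)"
    by (intro sum_mono) (auto intro: order_trans[OF degree_smult_le])
  also have "\<dots> = n" using assms by simp
  finally show ?thesis .
qed

lemma lagrange_interpolation:
  fixes p :: "real poly"
  assumes "degree p \<le> n"
  shows "p = (\<Sum>i\<le>n. smult (poly p (real i)) (lagrange_basis n i))" (is "p = ?q")
proof (rule poly_eqI_degree)
  show "poly p x = poly ?q x" if "x \<in> real ` {..n}" for x
  proof -
    obtain k where k: "k \<le> n" "x = real k" using \<open>x \<in> real ` {..n}\<close> by auto
    have "poly ?q x = (\<Sum>i\<le>n. if i = k then poly p (real i) else 0)"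
      unfolding poly_sum using k by (intro sum.cong) (auto simp: poly_lagrange_basis)
    also have "\<dots> = poly p x" using k by simp
    finally show ?thesis by simp
  qed
  have c: "card (real ` {..n}) = Suc n" by (simp add: card_image inj_on_def)
  have "degree ?q \<le> n"
    by (intro degree_sum_le) (auto intro: order_trans[OF degree_smult_le] degree_lagrange_basis)
  then show "degree p < card (real ` {..n})" "degree ?q < card (real ` {..n})"
    using assms c by auto
qed

text \<open>Under a common degree bound, interpolation expresses values and coefficients as fixed
  linear combinations of \<open>n + 1\<close> values, so convergence at the nodes carries over to
  all of them.\<close>

lemma poly_pointwise_limit:
  fixes p :: "nat \<Rightarrow> real poly"
  assumes deg: "\<And>m. degree (p m) \<le> n"
    and lim: "\<And>t. 0 \<le> t \<Longrightarrow> (\<lambda>m. poly (p m) t) \<longlonglongrightarrow> g t"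
  shows "\<exists>Q. degree Q \<le> n \<and> (\<forall>t\<ge>0. poly Q t = g t) \<and> (\<forall>j. (\<lambda>m. coeff (p m) j) \<longlonglongrightarrow> coeff Q j)"
proof (intro exI conjI allI impI)
  let ?Q = "\<Sum>i\<le>n. smult (g (real i)) (lagrange_basis n i)"
  show "degree ?Q \<le> n"
    by (intro degree_sum_le) (auto intro: order_trans[OF degree_smult_le] degree_lagrange_basis)
  show "(\<lambda>m. coeff (p m) j) \<longlonglongrightarrow> coeff ?Q j" for j
    by (subst lagrange_interpolation[OF deg]) (auto simp: coeff_sum intro!: tendsto_intros lim)
  show "poly ?Q t = g t" if "0 \<le> t" for t
  proof (rule LIMSEQ_unique)
    show "(\<lambda>m. poly (p m) t) \<longlonglongrightarrow> g t" using that by (rule lim)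
    show "(\<lambda>m. poly (p m) t) \<longlonglongrightarrow> poly ?Q t"
      by (subst lagrange_interpolation[OF deg]) (auto simp: poly_sum intro!: tendsto_intros lim)
  qed
qed

section \<open>Volumes of dilates and sums of balls\<close>

lemma vol_scaleR:
  fixes A :: "'a::euclidean_space set"
  shows "vol ((*\<^sub>R) s ` A) = \<bar>s\<bar> ^ DIM('a) * vol A"
  using measure_lebesgue_affine[of s 0 A] by simp

lemma scaleR_cball_0:
  assumes "0 \<le> s" "0 \<le> r"
  shows "(*\<^sub>R) s ` cball (0::'a::euclidean_space) r = cball 0 (s * r)"
proof (cases "s = 0")
  case True
  then show ?thesis using assms by (auto simp: image_iff intro!: exI[of _ 0])
next
  case False
  then show ?thesis using assms cball_scale[of s 0 r] by simp
qed

lemma vol_cball_0: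
  assumes "0 \<le> s"
  shows "vol (cball (0::'a::euclidean_space) s) = s ^ DIM('a) * vol (cball (0::'a) 1)"
  using vol_scaleR[of s "cball (0::'a) 1"] assms by (simp add: scaleR_cball_0)

lemma cball_0_plus:
  assumes "0 \<le> r" "0 \<le> s"
  shows "cball (0::'a::euclidean_space) r + cball 0 s = cball 0 (r + s)"
proof (intro equalityI subsetI)
  fix x assume "x \<in> cball (0::'a) r + cball 0 s"
  then show "x \<in> cball 0 (r + s)" by (auto simp: set_plus_def intro: norm_triangle_le)
next
  fix x :: 'a assume x: "x \<in> cball 0 (r + s)"
  show "x \<in> cball 0 r + cball 0 s"
  proof (cases "r + s = 0")
    case True
    then have "r = 0" "s = 0" using assms by linarith+
    then show ?thesis using x by (simp add: set_plus_def)
  next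
    case False
    have "(r / (r + s)) *\<^sub>R x \<in> cball 0 r" "(s / (r + s)) *\<^sub>R x \<in> cball 0 s"
      using x assms False by (auto simp: divide_simps mult_left_mono)
    moreover have "x = (r / (r + s)) *\<^sub>R x + (s / (r + s)) *\<^sub>R x"
      using False by (simp add: scaleR_left_distrib[symmetric] add_divide_distrib[symmetric])
    ultimately show ?thesis by (metis set_plus_intro)
  qed
qed

text \<open>With \<kappa> the volume of the unit ball this is the volume of a ball of radius
  \<open>a + b t\<close>. It serves both as an exact Steiner polynomial and as a bound on
  growth.\<close>

lemma ball_poly:
  fixes a b \<kappa> :: real and n :: nat
  defines "q \<equiv> smult \<kappa> ([:a, b:] ^ n)"
  shows "poly q t = \<kappa> * (a + b * t) ^ n" "degree q \<le> n"
    "j \<le> n \<Longrightarrow> coeff q j = \<kappa> * (real (n choose j) * b ^ j * a ^ (n - j))"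
proof -
  show "poly q t = \<kappa> * (a + b * t) ^ n" by (simp add: q_def poly_power mult.commute)
  have "degree ([:a, b:] ^ n) \<le> degree [:a, b:] * n" by (rule degree_power_le)
  also have "\<dots> \<le> 1 * n" by (intro mult_right_mono) auto
  finally show "degree q \<le> n" unfolding q_def
    by (intro order_trans[OF degree_smult_le]) simp
  have e: "[:a, b:] = monom b 1 + [:a:]" by (simp add: monom_altdef)
  show "coeff q j = \<kappa> * (real (n choose j) * b ^ j * a ^ (n - j))" if "j \<le> n"
  proof -
    have "[:a, b:] ^ n = (\<Sum>k\<le>n. of_nat (n choose k) * monom b 1 ^ k * [:a:] ^ (n - k))"
      unfolding e by (rule binomial_ring)
    also have "\<dots> = (\<Sum>k\<le>n. monom (real (n choose k) * b ^ k * a ^ (n - k)) k)"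
      by (intro sum.cong refl) (simp add: monom_power poly_const_pow of_nat_poly smult_monom mult.commute mult.left_commute)
    finally have "coeff ([:a, b:] ^ n) j = (\<Sum>k\<le>n. if k = j then real (n choose k) * b ^ k * a ^ (n - k) else 0)"
      by (simp add: coeff_sum if_distrib cong: if_cong)
    then show ?thesis using that by (simp add: q_def)
  qed
qed

lemma degree_le_of_poly_le:
  fixes p q :: "real poly"
  assumes "\<And>t. 0 \<le> t \<Longrightarrow> 0 \<le> poly p t" "\<And>t. 0 \<le> t \<Longrightarrow> poly p t \<le> poly q t" "degree q \<le> n"
  shows "degree p \<le> n"
proof (rule ccontr)
  assume "\<not> degree p \<le> n"
  then have d: "degree q < degree p" using assms by simp
  have "coeff p (degree p) \<le> coeff q (degree p)"
    using assms d by (intro coeff_le_of_poly_le) auto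
  moreover have "coeff 0 (degree p) \<le> coeff p (degree p)"
    using assms by (intro coeff_le_of_poly_le) auto
  ultimately have "coeff p (degree p) = 0" using d by (simp add: coeff_eq_0)
  then show False using d by (simp add: leading_coeff_0_iff)
qed

text \<open>By construction the degree is bounded only by the number of generators. Enclosing
  \<open>K\<close> and the zonotope in balls bounds the growth by that of a ball, which gives the
  uniform bound required for the limit.\<close>

lemma degree_vol_plus_zonotope_poly:
  fixes w :: "'i \<Rightarrow> 'a::euclidean_space"
  assumes "finite I" "compact K"
    and p: "\<And>t. 0 \<le> t \<Longrightarrow> vol (K + (*\<^sub>R) t ` zonotope I w) = poly p t"
  shows "degree p \<le> DIM('a)"
proof -
  obtain R where R: "R > 0" "K \<subseteq> cball 0 R"
    using compact_imp_bounded[OF assms(2)] by (auto simp: bounded_pos subset_iff)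
  obtain R' where R': "R' > 0" "zonotope I w \<subseteq> cball 0 R'"
    using compact_imp_bounded[OF compact_zonotope[OF assms(1), of w]] by (auto simp: bounded_pos subset_iff)
  define q where "q = smult (vol (cball (0::'a) 1)) ([:R, R':] ^ DIM('a))"
  show ?thesis
  proof (rule degree_le_of_poly_le)
    show "degree q \<le> DIM('a)" unfolding q_def by (rule ball_poly)
    fix t :: real assume t: "0 \<le> t"
    show "0 \<le> poly p t" using p[OF t, symmetric] by simp
    have "(*\<^sub>R) t ` zonotope I w \<subseteq> cball 0 (t * R')"
      using R' t scaleR_cball_0[of t R', where 'a = 'a] by fastforce
    then have "K + (*\<^sub>R) t ` zonotope I w \<subseteq> cball 0 R + cball 0 (t * R')"
      using R by (intro set_plus_mono2)
    also have "\<dots> = cball 0 (R + R' * t)"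
      using R R' t by (subst cball_0_plus) (auto simp: mult.commute)
    finally have "poly p t \<le> vol (cball (0::'a) (R + R' * t))"
      unfolding p[OF t, symmetric] using assms
      by (intro vol_mono compact_set_plus compact_scaling) auto
    also have "\<dots> = poly q t"
      using R R' t by (subst vol_cball_0) (auto simp: q_def ball_poly(1) mult.commute)
    finally show "poly p t \<le> poly q t" .
  qed
qed

text \<open>
  For \<open>q \<in> K\<close>, convexity gives \<open>K \<subseteq> (1 + e) K - e q\<close> and \<open>(1 - e) K + e q \<subseteq> K\<close>; this turns the
  approximation of the ball into a two-sided bound with factors \<open>(1 \<plusminus> e)\<^sup>n\<close>.
\<close>

lemma vol_plus_approximate_ball:
  fixes K Z :: "'a::euclidean_space set"
  assumes K: "compact K" "convex K" "K \<noteq> {}" and Z: "compact Z" and e: "0 < e" "e < 1" and t: "0 \<le> t"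
    and out: "(+) p ` Z \<subseteq> cball 0 (1 + e)" and inn: "cball 0 (1 - e) \<subseteq> (+) p ` Z"
  shows "(1 - e) ^ DIM('a) * vol (K + cball 0 t) \<le> vol (K + (*\<^sub>R) t ` Z)"
    and "vol (K + (*\<^sub>R) t ` Z) \<le> (1 + e) ^ DIM('a) * vol (K + cball 0 t)"
proof -
  obtain q where q: "q \<in> K" using K(3) by blast
  have cZ: "compact (K + (*\<^sub>R) t ` Z)" and cB: "compact (K + cball 0 t)"
    using K Z by (auto intro!: compact_set_plus compact_scaling)
  have "(1 - e) ^ DIM('a) * vol (K + cball 0 t) = vol ((*\<^sub>R) (1 - e) ` (K + cball 0 t))"
    using e by (simp add: vol_scaleR)
  also have "\<dots> \<le> vol (K + (*\<^sub>R) t ` Z)"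
  proof (rule vol_translate_mono)
    \<comment> \<open>The shift by \<open>e q\<close> completes the shrunken point of
      \<open>K\<close> to a convex combination, and the shift by \<open>- t p\<close> undoes the
      centring of \<open>Z\<close>.\<close>
    show "(+) (e *\<^sub>R q - t *\<^sub>R p) ` (*\<^sub>R) (1 - e) ` (K + cball 0 t) \<subseteq> K + (*\<^sub>R) t ` Z"
    proof clarify
      fix x assume "x \<in> K + cball 0 t"
      then obtain a b where ab: "a \<in> K" "norm b \<le> t" "x = a + b" by (auto simp: set_plus_def)
      have "(1 - e) *\<^sub>R a + e *\<^sub>R q \<in> K" using ab q e by (intro convexD[OF K(2)]) auto
      moreover have "\<exists>z\<in>Z. (1 - e) *\<^sub>R b - t *\<^sub>R p = t *\<^sub>R z"
      proof (cases "t = 0")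
        case True
        have "(0::'a) \<in> (+) p ` Z" using inn e by (auto simp: subset_iff)
        then show ?thesis using True ab by auto
      next
        case False
        have "norm ((1 - e) *\<^sub>R (b /\<^sub>R t)) \<le> 1 - e"
          using False t ab e by (simp add: divide_simps mult_left_mono)
        then have "(1 - e) *\<^sub>R (b /\<^sub>R t) \<in> (+) p ` Z" using inn by auto
        then obtain z where z: "z \<in> Z" "(1 - e) *\<^sub>R (b /\<^sub>R t) = p + z" by blast
        have "(1 - e) *\<^sub>R b = t *\<^sub>R ((1 - e) *\<^sub>R (b /\<^sub>R t))" using False by simp
        also have "\<dots> = t *\<^sub>R p + t *\<^sub>R z" unfolding z(2) by (rule scaleR_add_right)
        finally have "(1 - e) *\<^sub>R b - t *\<^sub>R p = t *\<^sub>R z" by simp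
        then show ?thesis using z by blast
      qed
      ultimately have "((1 - e) *\<^sub>R a + e *\<^sub>R q) + ((1 - e) *\<^sub>R b - t *\<^sub>R p) \<in> K + (*\<^sub>R) t ` Z"
        by (intro set_plus_intro) auto
      then show "e *\<^sub>R q - t *\<^sub>R p + (1 - e) *\<^sub>R x \<in> K + (*\<^sub>R) t ` Z"
        by (simp add: ab algebra_simps)
    qed
  qed (use cZ cB in \<open>auto intro: compact_scaling\<close>)
  finally show "(1 - e) ^ DIM('a) * vol (K + cball 0 t) \<le> vol (K + (*\<^sub>R) t ` Z)" .
  have "vol (K + (*\<^sub>R) t ` Z) \<le> vol ((*\<^sub>R) (1 + e) ` (K + cball 0 t))"
  proof (rule vol_translate_mono)
    show "(+) (t *\<^sub>R p + e *\<^sub>R q) ` (K + (*\<^sub>R) t ` Z) \<subseteq> (*\<^sub>R) (1 + e) ` (K + cball 0 t)"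
    proof clarify
      fix x assume "x \<in> K + (*\<^sub>R) t ` Z"
      then obtain a z where az: "a \<in> K" "z \<in> Z" "x = a + t *\<^sub>R z" by (auto simp: set_plus_def)
      define a' where "a' = (1 / (1 + e)) *\<^sub>R a + (e / (1 + e)) *\<^sub>R q"
      define b' where "b' = (t / (1 + e)) *\<^sub>R (p + z)"
      have "a' \<in> K" unfolding a'_def using az q e
        by (intro convexD[OF K(2)]) (auto simp: add_divide_distrib[symmetric])
      moreover have "norm (p + z) \<le> 1 + e" using out az by auto
      then have "norm b' \<le> t" using e t by (simp add: b'_def divide_simps mult_left_mono)
      ultimately have "a' + b' \<in> K + cball 0 t" by (intro set_plus_intro) auto
      moreover have "t *\<^sub>R p + e *\<^sub>R q + x = (1 + e) *\<^sub>R (a' + b')"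
        using e by (simp add: a'_def b'_def az scaleR_add_right)
      ultimately show "t *\<^sub>R p + e *\<^sub>R q + x \<in> (*\<^sub>R) (1 + e) ` (K + cball 0 t)" by blast
    qed
  qed (use cZ cB in \<open>auto intro: compact_scaling\<close>)
  also have "\<dots> = (1 + e) ^ DIM('a) * vol (K + cball 0 t)"
    using e by (simp add: vol_scaleR)
  finally show "vol (K + (*\<^sub>R) t ` Z) \<le> (1 + e) ^ DIM('a) * vol (K + cball 0 t)" .
qed

text \<open>The order of quantifiers matters: one sequence of generators serves every body, so
  \<open>K\<close> and the ball can later be compared generator by generator.\<close>

lemma zonotope_vol_limit:
  "\<exists>N (w :: nat \<Rightarrow> nat \<Rightarrow> 'a::euclidean_space). \<forall>K t. compact K \<longrightarrow> convex K \<longrightarrow> K \<noteq> {} \<longrightarrow> 0 \<le> t \<longrightarrow>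
     (\<lambda>m. vol (K + (*\<^sub>R) t ` zonotope {..<N m} (w m))) \<longlonglongrightarrow> vol (K + cball 0 t)"
proof -
  \<comment> \<open>Two successors keep \<open>e m\<close> strictly below 1 from the start.\<close>
  define e where "e m = inverse (real (Suc (Suc m)))" for m
  have e: "0 < e m" "e m < 1" for m by (auto simp: e_def divide_simps)
  have e_lim: "e \<longlonglongrightarrow> 0" unfolding e_def by (rule LIMSEQ_Suc[OF LIMSEQ_inverse_real_of_nat])
  have "\<forall>m. \<exists>N (w :: nat \<Rightarrow> 'a) p. (+) p ` zonotope {..<N} w \<subseteq> cball 0 (1 + e m) \<and>
           cball 0 (1 - e m) \<subseteq> (+) p ` zonotope {..<N} w"
    using zonotope_approximates_ball e by blast
  then obtain N and w :: "nat \<Rightarrow> nat \<Rightarrow> 'a" and p where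
    out: "\<And>m. (+) (p m) ` zonotope {..<N m} (w m) \<subseteq> cball 0 (1 + e m)" and
    inn: "\<And>m. cball 0 (1 - e m) \<subseteq> (+) (p m) ` zonotope {..<N m} (w m)"
    by metis
  show ?thesis
  proof (intro exI[of _ N] exI[of _ w] allI impI)
    fix K :: "'a set" and t :: real
    assume *: "compact K" "convex K" "K \<noteq> {}" "0 \<le> t"
    let ?V = "vol (K + cball 0 t)"
    show "(\<lambda>m. vol (K + (*\<^sub>R) t ` zonotope {..<N m} (w m))) \<longlonglongrightarrow> ?V"
    proof (rule tendsto_sandwich)
      show "\<forall>\<^sub>F m in sequentially. (1 - e m) ^ DIM('a) * ?V \<le> vol (K + (*\<^sub>R) t ` zonotope {..<N m} (w m))"
        using vol_plus_approximate_ball(1)[OF *(1-3) _ e *(4) out inn] by auto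
      show "\<forall>\<^sub>F m in sequentially. vol (K + (*\<^sub>R) t ` zonotope {..<N m} (w m)) \<le> (1 + e m) ^ DIM('a) * ?V"
        using vol_plus_approximate_ball(2)[OF *(1-3) _ e *(4) out inn] by auto
      have "(\<lambda>m. (1 - e m) ^ DIM('a) * ?V) \<longlonglongrightarrow> (1 - 0) ^ DIM('a) * ?V"
        by (intro tendsto_intros e_lim)
      then show "(\<lambda>m. (1 - e m) ^ DIM('a) * ?V) \<longlonglongrightarrow> ?V" by simp
      have "(\<lambda>m. (1 + e m) ^ DIM('a) * ?V) \<longlonglongrightarrow> (1 + 0) ^ DIM('a) * ?V"
        by (intro tendsto_intros e_lim)
      then show "(\<lambda>m. (1 + e m) ^ DIM('a) * ?V) \<longlonglongrightarrow> ?V" by simp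
    qed
  qed
qed

section \<open>Volumes and projections\<close>

lemma emeasure_lborel_compact:
  assumes "compact A"
  shows "emeasure lborel A = ennreal (vol A)"
proof -
  have "A \<in> sets borel" using assms by (simp add: borel_compact)
  then have "vol A = measure lborel A" by (simp add: measure_completion)
  then show ?thesis
    using emeasure_compact_finite[OF assms] by (simp add: emeasure_eq_ennreal_measure less_top)
qed

text \<open>Orthogonal projection onto a subspace is encoded as the adjoint \<open>proj\<close> of
  an isometry from \<open>'b\<close>. Projected bodies then live in the type \<open>'b\<close>
  itself, where a bound for full-dimensional bodies applies.\<close>

locale isometric_embedding =
  fixes i :: "'b::euclidean_space \<Rightarrow> 'a::euclidean_space"
  assumes linear_i: "linear i" and norm_i: "\<And>y. norm (i y) = norm y"
begin

lemma inner_i: "i y \<bullet> i z = y \<bullet> z"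
  using norm_i[of "y + z"] by (simp add: dot_norm norm_i linear_add[OF linear_i])

definition proj :: "'a \<Rightarrow> 'b" where "proj = adjoint i"

lemma inner_proj: "proj x \<bullet> y = x \<bullet> i y"
  unfolding proj_def by (metis adjoint_works linear_i inner_commute)

lemma inner_proj_simps: "x \<bullet> i y = proj x \<bullet> y" "i y \<bullet> x = y \<bullet> proj x"
  by (metis inner_proj) (metis inner_proj inner_commute)

lemma linear_proj: "linear proj"
  unfolding proj_def by (rule adjoint_linear[OF linear_i])

lemma proj_i [simp]: "proj (i y) = y"
proof -
  have "(proj (i y) - y) \<bullet> z = 0" for z
    by (simp add: inner_diff_left inner_proj inner_i)
  then show ?thesis using inner_eq_zero_iff by (metis eq_iff_diff_eq_0)
qed

lemma proj_add: "proj (x + y) = proj x + proj y" and proj_diff: "proj (x - y) = proj x - proj y"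
  by (auto simp: linear_add[OF linear_proj] linear_diff[OF linear_proj])

lemma i_add: "i (x + y) = i x + i y"
  by (rule linear_add[OF linear_i])

lemma norm_split: "(norm x)\<^sup>2 = (norm (x - i (proj x)))\<^sup>2 + (norm (proj x))\<^sup>2"
  by (simp add: power2_norm_eq_inner inner_diff_left inner_diff_right inner_i inner_proj_simps proj_diff)

lemma norm_proj_le: "norm (proj x) \<le> norm x" and norm_residual_le: "norm (x - i (proj x)) \<le> norm x"
  by (rule power2_le_imp_le; simp add: norm_split[of x])+

lemma compact_proj: "compact A \<Longrightarrow> compact (proj ` A)"
  using linear_proj by (intro compact_continuous_image linear_continuous_on) (simp add: linear_conv_bounded_linear)

lemma compact_i: "compact A \<Longrightarrow> compact (i ` A)"
  using linear_i by (intro compact_continuous_image linear_continuous_on) (simp add: linear_conv_bounded_linear)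

lemma compact_ball_kernel: "compact {x \<in> cball 0 1. proj x = 0}"
proof -
  have "{x \<in> cball 0 1. proj x = 0} = cball 0 1 \<inter> proj -` {0}" by auto
  moreover have "closed (proj -` {0})"
    using linear_proj
    by (intro continuous_closed_vimage linear_continuous_at) (auto simp: linear_conv_bounded_linear)
  ultimately show ?thesis by (simp add: compact_Int_closed)
qed

text \<open>
  Exchanging the \<open>i\<close>-component of a vector of \<open>'a\<close> with a vector of \<open>'b\<close> is an orthogonal involution of
  \<open>'b \<times> 'a\<close>; Fubini for its image of \<open>Q \<times> X\<close> disintegrates \<open>X\<close> along \<open>proj\<close>.
\<close>

lemma emeasure_slices:
  assumes Q: "Q \<in> sets borel" and X: "X \<in> sets borel"
  shows "emeasure lborel Q * emeasure lborel X =
    (\<integral>\<^sup>+y. emeasure lborel {z. proj z \<in> Q \<and> z - i (proj z) + i y \<in> X} \<partial>lborel)"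
proof -
  define T where "T = (\<lambda>(y, z). (proj z, z - i (proj z) + i y))"
  have "linear T"
    by (rule linearI) (auto simp: T_def proj_add i_add linear_scale[OF linear_proj] linear_scale[OF linear_i] algebra_simps)
  moreover have "norm (T v) = norm v" for v
  proof -
    obtain y z where v: "v = (y, z)" by (cases v)
    have "(norm (z - i (proj z) + i y))\<^sup>2 = (norm (z - i (proj z)))\<^sup>2 + (norm y)\<^sup>2"
      by (simp add: power2_norm_eq_inner inner_add_left inner_add_right inner_diff_left inner_diff_right
          inner_i inner_proj_simps inner_commute)
    then show ?thesis using norm_split[of z] by (simp add: v T_def norm_Pair)
  qed
  ultimately have T: "orthogonal_transformation T" by (simp add: orthogonal_transformation)
  have QX: "Q \<times> X \<in> sets borel" using Q X by (simp add: borel_prod[symmetric])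
  have "continuous_on UNIV T"
    using \<open>linear T\<close> by (intro linear_continuous_on) (simp add: linear_conv_bounded_linear)
  then have "T \<in> borel_measurable borel" by (rule borel_measurable_continuous_onI)
  then have TQX: "T -` (Q \<times> X) \<in> sets (lborel \<Otimes>\<^sub>M lborel)"
    unfolding lborel_prod sets_lborel using QX by (rule measurable_sets_borel)
  have "emeasure lborel Q * emeasure lborel X = emeasure (lborel \<Otimes>\<^sub>M lborel) (Q \<times> X)"
    using Q X by (simp add: lborel.emeasure_pair_measure_Times)
  also have "\<dots> = emeasure (lborel \<Otimes>\<^sub>M lborel) (T -` (Q \<times> X))"
    using vimage_measure_lborel_orthogonal[OF T QX] by (simp add: lborel_prod)
  also have "\<dots> = (\<integral>\<^sup>+y. emeasure lborel (Pair y -` (T -` (Q \<times> X))) \<partial>lborel)"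
    using TQX by (rule lborel.emeasure_pair_measure_alt)
  also have "\<dots> = (\<integral>\<^sup>+y. emeasure lborel {z. proj z \<in> Q \<and> z - i (proj z) + i y \<in> X} \<partial>lborel)"
    by (intro nn_integral_cong arg_cong[of _ _ "emeasure lborel"]) (auto simp: T_def)
  finally show ?thesis .
qed

lemma slices_measurable:
  assumes Q: "Q \<in> sets borel" and X: "X \<in> sets borel"
  shows "{z. proj z \<in> Q \<and> z - i (proj z) + i y \<in> X} \<in> sets borel"
proof -
  have [measurable]: "proj \<in> borel_measurable borel" "i \<in> borel_measurable borel"
    using linear_proj linear_i
    by (auto intro!: borel_measurable_continuous_onI linear_continuous_on simp: linear_conv_bounded_linear)
  note Q[measurable] X[measurable]
  have "{z \<in> space borel. proj z \<in> Q \<and> z - i (proj z) + i y \<in> X} \<in> sets borel" by measurable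
  then show ?thesis by simp
qed

text \<open>Over a point \<open>y = proj x\<close> with \<open>x\<close> in \<open>K\<close>, the
  slice contains the translate of \<open>P + i Q\<close> by \<open>x - i y\<close>, because
  \<open>P\<close> lies in the kernel. Integration over the projection of \<open>K\<close> gives the
  bound.\<close>

lemma slices_lower:
  assumes K: "compact K" and P: "compact P" and Q: "compact Q" and ker: "\<And>x. x \<in> P \<Longrightarrow> proj x = 0"
  shows "vol (proj ` K) * vol (P + i ` Q) \<le> vol Q * vol (K + P)"
proof -
  have cKP: "compact (K + P)" using K P by (rule compact_set_plus)
  have cPQ: "compact (P + i ` Q)" using P Q by (intro compact_set_plus compact_i)
  have "ennreal (vol (proj ` K) * vol (P + i ` Q))
      = (\<integral>\<^sup>+y. emeasure lborel (P + i ` Q) * indicator (proj ` K) y \<partial>lborel)"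
    using compact_proj[OF K] cPQ
    by (subst nn_integral_cmult_indicator)
       (auto simp: emeasure_lborel_compact ennreal_mult borel_compact mult.commute)
  also have "\<dots> \<le> (\<integral>\<^sup>+y. emeasure lborel {z. proj z \<in> Q \<and> z - i (proj z) + i y \<in> K + P} \<partial>lborel)"
  proof (rule nn_integral_mono)
    fix y
    show "emeasure lborel (P + i ` Q) * indicator (proj ` K) y
        \<le> emeasure lborel {z. proj z \<in> Q \<and> z - i (proj z) + i y \<in> K + P}"
    proof (cases "y \<in> proj ` K")
      case True
      then obtain x where x: "x \<in> K" "y = proj x" by blast
      have "(+) (x - i y) ` (P + i ` Q) \<subseteq> {z. proj z \<in> Q \<and> z - i (proj z) + i y \<in> K + P}"
      proof clarify
        fix z assume "z \<in> P + i ` Q"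
        then obtain p q where pq: "p \<in> P" "q \<in> Q" "z = p + i q" by (auto simp: set_plus_def)
        have pz: "proj (x - i y + z) = q" using x pq ker by (simp add: proj_add proj_diff)
        have "x - i y + z - i q + i y = x + p" using pq by simp
        then show "proj (x - i y + z) \<in> Q \<and> x - i y + z - i (proj (x - i y + z)) + i y \<in> K + P"
          unfolding pz using x pq by auto
      qed
      then have "emeasure lborel ((+) (x - i y) ` (P + i ` Q))
          \<le> emeasure lborel {z. proj z \<in> Q \<and> z - i (proj z) + i y \<in> K + P}"
        using slices_measurable[of Q "K + P"] Q cKP by (intro emeasure_mono) (auto simp: borel_compact)
      moreover have "emeasure lborel ((+) (x - i y) ` (P + i ` Q)) = emeasure lborel (P + i ` Q)"
        using cPQ compact_translation[OF cPQ] by (simp add: emeasure_lborel_compact measure_translation)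
      ultimately show ?thesis using True by simp
    qed simp
  qed
  also have "\<dots> = emeasure lborel Q * emeasure lborel (K + P)"
    using Q cKP by (intro emeasure_slices[symmetric]) (auto simp: borel_compact)
  also have "\<dots> = ennreal (vol Q * vol (K + P))"
    using Q cKP by (simp add: emeasure_lborel_compact ennreal_mult)
  finally show ?thesis by simp
qed

text \<open>Removing the component in the range of \<open>i\<close> keeps a point of the ball in the
  ball. So all slices over the unit ball of \<open>'b\<close> lie in one fixed set, and the
  remaining slices are empty.\<close>

lemma slices_upper_ball:
  assumes P: "compact P" and Q: "compact Q" and ker: "\<And>x. x \<in> P \<Longrightarrow> proj x = 0"
  shows "vol Q * vol (cball 0 1 + P)
     \<le> vol (cball (0::'b) 1) * vol ({x \<in> cball 0 1. proj x = 0} + P + i ` Q)"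
proof -
  let ?F = "{x \<in> cball 0 1. proj x = 0}"
  have cPQ: "compact (?F + P + i ` Q)" using P Q by (intro compact_set_plus compact_i compact_ball_kernel)
  have cBP: "compact (cball (0::'a) 1 + P)" using P by (intro compact_set_plus) auto
  have "ennreal (vol Q * vol (cball (0::'a) 1 + P)) = emeasure lborel Q * emeasure lborel (cball (0::'a) 1 + P)"
    using Q cBP by (simp add: emeasure_lborel_compact ennreal_mult)
  also have "\<dots> = (\<integral>\<^sup>+y. emeasure lborel {z. proj z \<in> Q \<and> z - i (proj z) + i y \<in> cball 0 1 + P} \<partial>lborel)"
    using Q cBP by (intro emeasure_slices) (auto simp: borel_compact)
  also have "\<dots> \<le> (\<integral>\<^sup>+y. emeasure lborel (?F + P + i ` Q) * indicator (cball (0::'b) 1) y \<partial>lborel)"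
  proof (rule nn_integral_mono)
    fix y
    show "emeasure lborel {z. proj z \<in> Q \<and> z - i (proj z) + i y \<in> cball 0 1 + P}
       \<le> emeasure lborel (?F + P + i ` Q) * indicator (cball (0::'b) 1) y"
    proof -
      have *: "y \<in> cball 0 1 \<and> z \<in> ?F + P + i ` Q"
        if z: "proj z \<in> Q" "z - i (proj z) + i y \<in> cball 0 1 + P" for z
      proof -
        obtain b p where bp: "norm b \<le> 1" "p \<in> P" "z - i (proj z) + i y = b + p"
          using z(2) by (auto simp: set_plus_def)
        have "proj (z - i (proj z) + i y) = proj (b + p)" using bp by simp
        then have y: "y = proj b" using ker[OF bp(2)] by (simp add: proj_add proj_diff)
        have "norm y \<le> 1" using norm_proj_le[of b] bp y by simp
        moreover have "z = (b - i (proj b)) + p + i (proj z)" using bp y by (simp add: algebra_simps)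
        moreover have "b - i (proj b) \<in> ?F"
          using norm_residual_le[of b] bp by (simp add: proj_diff)
        moreover have "(b - i (proj b)) + p + i (proj z) \<in> ?F + P + i ` Q"
          using calculation bp z by (intro set_plus_intro imageI)
        ultimately show ?thesis by simp
      qed
      show ?thesis
      proof (cases "y \<in> cball 0 1")
        case True
        have "emeasure lborel {z. proj z \<in> Q \<and> z - i (proj z) + i y \<in> cball 0 1 + P} \<le> emeasure lborel (?F + P + i ` Q)"
          using * cPQ by (intro emeasure_mono) (auto simp: borel_compact)
        then show ?thesis using True by simp
      next
        case False
        then have "{z. proj z \<in> Q \<and> z - i (proj z) + i y \<in> cball 0 1 + P} = {}" using * by blast
        then show ?thesis by (metis emeasure_empty zero_le)
      qed
    qed
  qed
  also have "\<dots> = ennreal (vol (cball (0::'b) 1) * vol (?F + P + i ` Q))"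
    using cPQ by (subst nn_integral_cmult_indicator)
       (auto simp: emeasure_lborel_compact ennreal_mult mult.commute)
  finally show ?thesis by (simp add: zero_le_mult_iff)
qed

text \<open>The upper estimate for the ball exceeds the lower one for \<open>K\<close> by the unit
  ball of the kernel. Passing from \<open>P\<close> to the larger \<open>P'\<close> absorbs this
  surplus; later both are dilates of one zonotope.\<close>

lemma slices_compare:
  assumes K: "compact K" and P: "compact P" "compact P'"
    and ker: "\<And>x. x \<in> P \<Longrightarrow> proj x = 0" "\<And>x. x \<in> P' \<Longrightarrow> proj x = 0"
    and sub: "(+) s ` ({x \<in> cball 0 1. proj x = 0} + P) \<subseteq> P'"
    and c: "0 \<le> c" "c * vol (cball (0::'b) 1) \<le> vol (proj ` K)"
  shows "c * vol (cball 0 1 + P) \<le> vol (K + P')"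
proof -
  let ?Q = "cball (0::'b) 1" and ?F = "{x \<in> cball 0 1. proj x = 0}"
  have Q: "vol ?Q > 0" using content_cball_pos[of 1 "0::'b"] by (simp add: measure_completion)
  have sub': "(+) s ` (?F + P + i ` ?Q) \<subseteq> P' + i ` ?Q"
  proof clarify
    fix x assume "x \<in> ?F + P + i ` ?Q"
    then obtain a q where "a \<in> ?F + P" "q \<in> i ` ?Q" "x = a + q" by (meson set_plus_elim)
    then show "s + x \<in> P' + i ` ?Q" using sub by (auto simp: add.assoc[symmetric] intro!: set_plus_intro)
  qed
  have "vol ?Q * (c * vol (cball 0 1 + P)) \<le> c * (vol ?Q * vol (?F + P + i ` ?Q))"
    using mult_left_mono[OF slices_upper_ball[OF P(1) _ ker(1), of ?Q] c(1)] by (simp add: mult.left_commute)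
  also have "\<dots> = (c * vol ?Q) * vol (?F + P + i ` ?Q)" by simp
  also have "\<dots> \<le> vol (proj ` K) * vol (P' + i ` ?Q)"
    using c P compact_ball_kernel sub' by (intro mult_mono vol_translate_mono[of _ _ s] compact_set_plus compact_i) auto
  also have "\<dots> \<le> vol ?Q * vol (K + P')"
    using K P ker by (intro slices_lower) auto
  finally show ?thesis using Q by simp
qed

end

section \<open>Comparison of coefficients\<close>

lemma scaleR_convex_add:
  fixes Z :: "'a::euclidean_space set"
  assumes "convex Z" "Z \<noteq> {}" "0 \<le> a" "0 \<le> b"
  shows "(*\<^sub>R) a ` Z + (*\<^sub>R) b ` Z = (*\<^sub>R) (a + b) ` Z"
  using sum_scaled_convex[OF assms(1,2), of "UNIV :: bool set" "\<lambda>x. if x then a else b"] assms(3,4)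
  by (simp add: UNIV_bool add.commute)

lemma zonotope_nonempty [simp]: "finite I \<Longrightarrow> zonotope I w \<noteq> {}"
  using zero_in_zonotope[of I w] by blast

text \<open>Since 0 belongs to the zonotope, its affine hull is a linear span, and a relatively
  interior point carries a ball of radius \<open>e\<close> in it. The factor \<open>2 / e\<close>
  uses only half that radius, so that a closed unit ball fits into the dilate.\<close>

lemma zonotope_contains_ball_of_span:
  fixes w :: "'i \<Rightarrow> 'a::euclidean_space"
  assumes S: "finite S"
  obtains M s where "0 \<le> M" "(+) s ` (cball 0 1 \<inter> span (w ` S)) \<subseteq> (*\<^sub>R) M ` zonotope S w"
proof -
  let ?Z = "zonotope S w"
  have "rel_interior ?Z \<noteq> {}"
    using S by (simp add: rel_interior_eq_empty)
  then obtain p e where p: "p \<in> ?Z" "e > 0" "ball p e \<inter> affine hull ?Z \<subseteq> ?Z"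
    using mem_rel_interior_ball by blast
  have aff: "affine hull ?Z = span ?Z"
    using S by (intro affine_hull_span_0 hull_inc) simp
  have "w j \<in> ?Z" if "j \<in> S" for j
  proof -
    have "w j \<in> zonotope {j} w" by (simp add: zonotope_def)
    also have "\<dots> \<subseteq> ?Z" using S that by (intro zonotope_mono) auto
    finally show ?thesis .
  qed
  then have sub: "span (w ` S) \<subseteq> span ?Z" by (intro span_mono) auto
  show thesis
  proof
    show "0 \<le> 2 / e" using p by simp
    show "(+) ((2 / e) *\<^sub>R p) ` (cball 0 1 \<inter> span (w ` S)) \<subseteq> (*\<^sub>R) (2 / e) ` ?Z"
    proof clarify
      fix x assume x: "x \<in> cball 0 1" "x \<in> span (w ` S)"
      have "p + (e / 2) *\<^sub>R x \<in> ball p e"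
        using x p by (simp add: dist_norm)
      moreover have "p + (e / 2) *\<^sub>R x \<in> span ?Z"
        using x sub p by (intro span_add span_scale) (auto intro: span_base)
      ultimately have "p + (e / 2) *\<^sub>R x \<in> ?Z" using p aff by auto
      moreover have "(2 / e) *\<^sub>R p + x = (2 / e) *\<^sub>R (p + (e / 2) *\<^sub>R x)"
        using p by (simp add: scaleR_add_right)
      ultimately show "(2 / e) *\<^sub>R p + x \<in> (*\<^sub>R) (2 / e) ` ?Z" by blast
    qed
  qed
qed

lemma zonotope_subset_span:
  assumes "finite S"
  shows "zonotope S w \<subseteq> span (w ` S)"
  using assms
proof (induction S rule: finite_induct)
  case (insert j S)
  show ?case
  proof
    fix x assume "x \<in> zonotope (insert j S) w"
    then obtain s z where z: "z \<in> zonotope S w" "x = s *\<^sub>R w j + z"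
      using insert.hyps by (auto simp: zonotope_insert set_plus_def closed_segment_def)
    have "z \<in> span (w ` insert j S)"
      using z(1) insert.IH span_mono[of "w ` S" "w ` insert j S"] by auto
    moreover have "w j \<in> span (w ` insert j S)" by (rule span_base) simp
    ultimately show "x \<in> span (w ` insert j S)"
      unfolding z(2) by (intro span_add span_scale)
  qed
qed (simp add: span_0)

text \<open>This makes the slack harmless: replacing a dilation factor \<open>t\<close> by
  \<open>M + t\<close> costs nothing in the top coefficient.\<close>

lemma coeff_pcompose_shift:
  fixes p :: "real poly"
  assumes "degree p \<le> d"
  shows "coeff (pcompose p [:a, 1:]) d = coeff p d"
proof (cases "degree p = d")
  case True
  then show ?thesis using lead_coeff_comp[of "[:a, 1:]" p] degree_pcompose[of p "[:a, 1:]"] by simp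
next
  case False
  then show ?thesis using assms degree_pcompose[of p "[:a, 1:]"] by (simp add: coeff_eq_0)
qed

lemma degree_pcompose_linear_le: "degree (pcompose p [:a, b:]) \<le> degree (p :: real poly)"
  unfolding degree_pcompose by simp

text \<open>Independence is required of the family and not of its image, so it also excludes
  repeated vectors.\<close>

lemma dim_span_eq_card:
  fixes w :: "'i \<Rightarrow> 'a::euclidean_space"
  assumes S: "finite S" and ind: "\<And>j. j \<in> S \<Longrightarrow> w j \<notin> span (w ` (S - {j}))"
  shows "dim (w ` S) = card S"
proof -
  have inj: "inj_on w S"
  proof (rule inj_onI)
    fix j k assume jk: "j \<in> S" "k \<in> S" "w j = w k"
    show "j = k"
    proof (rule ccontr)
      assume "j \<noteq> k"
      then have "w j \<in> w ` (S - {j})" using jk by (intro image_eqI[of _ _ k]) auto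
      from span_base[OF this] ind[OF jk(1)] show False by simp
    qed
  qed
  have "independent (w ` S)"
    unfolding dependent_def
  proof clarify
    fix j assume j: "j \<in> S" "w j \<in> span (w ` S - {w j})"
    have "w ` S - {w j} = w ` (S - {j})" using inj j by (auto simp: inj_on_def)
    then show False using ind j by simp
  qed
  then have "dim (w ` S) = card (w ` S)" by (rule dim_eq_card_independent)
  then show ?thesis using inj by (simp add: card_image)
qed

text \<open>A segment in the span of the other generators fits, up to translation, into a dilate of
  their zonotope with factor proportional to \<open>t\<close>. The volume thus grows at most like a
  polynomial of degree below \<open>card S\<close>.\<close>

lemma coeff_dependent_le_0:
  fixes w :: "'i \<Rightarrow> 'a::euclidean_space"
  assumes S: "finite S" and K: "compact K"
    and f: "\<And>T t. T \<subseteq> S \<Longrightarrow> 0 \<le> t \<Longrightarrow> vol (K + (*\<^sub>R) t ` zonotope T w) = poly (subset_poly f T) t"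
    and j: "j \<in> S" "w j \<in> span (w ` (S - {j}))"
  shows "f S \<le> 0"
proof -
  let ?T = "S - {j}"
  have T: "finite ?T" using S by simp
  obtain M s where M: "0 \<le> M" "(+) s ` (cball 0 1 \<inter> span (w ` ?T)) \<subseteq> (*\<^sub>R) M ` zonotope ?T w"
    using zonotope_contains_ball_of_span[OF T] by blast
  define r where "r = norm (w j)"
  \<comment> \<open>In the factor \<open>1 + r * M\<close>, the 1 accounts for the remaining
    zonotope and \<open>r * M\<close> for the segment of length \<open>r\<close>.\<close>
  define p where "p = pcompose (subset_poly f ?T) [:0, 1 + r * M:]"
  have r: "0 \<le> r" by (simp add: r_def)
  have "poly (subset_poly f S) t \<le> poly p t" if t: "0 \<le> t" for t
  proof -
    have seg: "(+) ((t * r) *\<^sub>R s) ` closed_segment 0 (t *\<^sub>R w j) \<subseteq> (*\<^sub>R) (t * r * M) ` zonotope ?T w"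
    proof clarify
      fix x assume "x \<in> closed_segment 0 (t *\<^sub>R w j)"
      then obtain u where u: "0 \<le> u" "u \<le> 1" "x = (u * t) *\<^sub>R w j"
        by (auto simp: closed_segment_def)
      \<comment> \<open>For \<open>w j = 0\<close> division by zero gives \<open>y = 0\<close>, and
        the representation of \<open>x\<close> below still holds.\<close>
      define y where "y = (u / r) *\<^sub>R w j"
      have "norm y \<le> 1" using u r by (simp add: y_def r_def)
      moreover have "y \<in> span (w ` ?T)" unfolding y_def by (intro span_scale j)
      ultimately obtain z where z: "z \<in> zonotope ?T w" "s + y = M *\<^sub>R z" using M by fastforce
      have "x = (t * r) *\<^sub>R y" using u by (cases "w j = 0") (auto simp: y_def r_def)
      then have "(t * r) *\<^sub>R s + x = (t * r) *\<^sub>R (s + y)" by (simp add: scaleR_add_right)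
      also have "\<dots> = (t * r * M) *\<^sub>R z" using z by simp
      finally show "(t * r) *\<^sub>R s + x \<in> (*\<^sub>R) (t * r * M) ` zonotope ?T w" using z by blast
    qed
    have Z: "(*\<^sub>R) t ` zonotope S w = closed_segment 0 (t *\<^sub>R w j) + (*\<^sub>R) t ` zonotope ?T w"
      using S j T zonotope_insert[of ?T j "\<lambda>i. t *\<^sub>R w i"] by (simp add: scaleR_zonotope insert_absorb)
    have "(+) ((t * r) *\<^sub>R s) ` (K + (*\<^sub>R) t ` zonotope S w)
        \<subseteq> K + ((*\<^sub>R) (t * r * M) ` zonotope ?T w + (*\<^sub>R) t ` zonotope ?T w)"
    proof clarify
      fix v assume "v \<in> K + (*\<^sub>R) t ` zonotope S w"
      then obtain a b where a: "v = a + b" "a \<in> K" "b \<in> (*\<^sub>R) t ` zonotope S w" by (rule set_plus_elim)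
      from a(3) obtain x y where b: "b = x + y" "x \<in> closed_segment 0 (t *\<^sub>R w j)" "y \<in> (*\<^sub>R) t ` zonotope ?T w"
        unfolding Z by (rule set_plus_elim)
      have "a + (((t * r) *\<^sub>R s + x) + y) \<in> K + ((*\<^sub>R) (t * r * M) ` zonotope ?T w + (*\<^sub>R) t ` zonotope ?T w)"
        using a b seg by (intro set_plus_intro) auto
      then show "(t * r) *\<^sub>R s + v \<in> K + ((*\<^sub>R) (t * r * M) ` zonotope ?T w + (*\<^sub>R) t ` zonotope ?T w)"
        by (simp add: a(1) b(1) algebra_simps)
    qed
    also have "(*\<^sub>R) (t * r * M) ` zonotope ?T w + (*\<^sub>R) t ` zonotope ?T w = (*\<^sub>R) (t * r * M + t) ` zonotope ?T w"
      using T t r M by (intro scaleR_convex_add) auto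
    finally have "vol (K + (*\<^sub>R) t ` zonotope S w) \<le> vol (K + (*\<^sub>R) (t * r * M + t) ` zonotope ?T w)"
      using K S T by (intro vol_translate_mono) (auto intro!: compact_set_plus compact_scaling)
    also have "\<dots> = poly (subset_poly f ?T) (t * r * M + t)"
      using t r M by (intro f) auto
    also have "\<dots> = poly p t"
      by (simp add: p_def poly_pcompose algebra_simps)
    finally show ?thesis using f[of S t] t by simp
  qed
  moreover have "degree p < card S"
  proof -
    have "degree p \<le> degree (subset_poly f ?T)" unfolding p_def by (rule degree_pcompose_linear_le)
    also have "\<dots> \<le> card ?T" using T by (rule degree_subset_poly)
    also have "\<dots> < card S" using S j by (intro psubset_card_mono) auto
    finally show ?thesis .
  qed
  ultimately have "coeff (subset_poly f S) (card S) \<le> coeff p (card S)"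
    using S by (intro coeff_le_of_poly_le degree_subset_poly) auto
  then show ?thesis
    using S \<open>degree p < card S\<close> by (simp add: lead_coeff_subset_poly coeff_eq_0)
qed

text \<open>Equal dimension makes \<open>'b\<close> isometric to the complement of \<open>V\<close>;
  the kernel of the adjoint is then the double complement, which is \<open>V\<close>.\<close>

lemma isometric_embedding_onto_orthogonal_complement:
  fixes V :: "'a::euclidean_space set"
  assumes "subspace V" "dim V + DIM('b) = DIM('a)"
  shows "\<exists>i :: 'b::euclidean_space \<Rightarrow> 'a. isometric_embedding i \<and>
           (\<forall>x. isometric_embedding.proj i x = 0 \<longleftrightarrow> x \<in> V)"
proof -
  let ?E = "V\<^sup>\<bottom>"
  have E: "?E = {y \<in> UNIV. \<forall>x\<in>V. orthogonal x y}" by (auto simp: orthogonal_comp_def)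
  have "dim ?E + dim V = DIM('a)"
    unfolding E using dim_subspace_orthogonal_to_vectors[OF assms(1) subspace_UNIV] by simp
  then have "dim (UNIV :: 'b set) = dim ?E" using assms by simp
  then obtain i :: "'b \<Rightarrow> 'a" where i: "linear i" "range i = ?E" "\<And>y. norm (i y) = norm y"
    using isometry_subspaces[OF subspace_UNIV subspace_orthogonal_comp, of V] by (metis UNIV_I)
  interpret isometric_embedding i using i(1,3) by (rule isometric_embedding.intro)
  have "proj x = 0 \<longleftrightarrow> x \<in> V" for x
  proof -
    have "proj x = 0 \<longleftrightarrow> (\<forall>y. proj x \<bullet> y = 0)" using inner_eq_zero_iff by auto
    also have "\<dots> \<longleftrightarrow> (\<forall>z\<in>?E. x \<bullet> z = 0)" by (simp add: inner_proj i(2)[symmetric])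
    also have "\<dots> \<longleftrightarrow> x \<in> ?E\<^sup>\<bottom>" by (auto simp: orthogonal_comp_def orthogonal_def inner_commute)
    finally show ?thesis using orthogonal_comp_self[OF assms(1)] by simp
  qed
  then show ?thesis using isometric_embedding_axioms by blast
qed

text \<open>Projecting along the span of the generators puts all dilates of the zonotope into the
  kernel. The unit ball of this kernel fits into the dilate by \<open>M\<close>, so the ball at
  \<open>t\<close> is compared with \<open>K\<close> at \<open>M + t\<close>.\<close>

lemma coeff_independent_compare:
  fixes w :: "'i \<Rightarrow> 'a::euclidean_space"
  assumes S: "finite S" "card S + DIM('b::euclidean_space) = DIM('a)"
    and K: "compact K" "0 \<le> c"
    and fK: "\<And>t. 0 \<le> t \<Longrightarrow> vol (K + (*\<^sub>R) t ` zonotope S w) = poly (subset_poly fK S) t"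
    and fB: "\<And>t. 0 \<le> t \<Longrightarrow> vol (cball 0 1 + (*\<^sub>R) t ` zonotope S w) = poly (subset_poly fB S) t"
    and proj: "\<And>i :: 'b \<Rightarrow> 'a. isometric_embedding i \<Longrightarrow>
       c * vol (cball (0::'b) 1) \<le> vol (isometric_embedding.proj i ` K)"
    and ind: "\<And>j. j \<in> S \<Longrightarrow> w j \<notin> span (w ` (S - {j}))"
  shows "c * fB S \<le> fK S"
proof -
  let ?V = "span (w ` S)" and ?Z = "zonotope S w"
  have "dim ?V + DIM('b) = DIM('a)" using dim_span_eq_card[OF S(1) ind] S(2) by simp
  then obtain i :: "'b \<Rightarrow> 'a" where i: "isometric_embedding i"
    and ker: "\<And>x. isometric_embedding.proj i x = 0 \<longleftrightarrow> x \<in> ?V"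
    using isometric_embedding_onto_orthogonal_complement[of ?V] by auto
  interpret isometric_embedding i by fact
  obtain M s where M: "0 \<le> M" "(+) s ` (cball 0 1 \<inter> ?V) \<subseteq> (*\<^sub>R) M ` ?Z"
    using zonotope_contains_ball_of_span[OF S(1)] by blast
  define p where "p = pcompose (subset_poly fK S) [:M, 1:]"
  have Z: "convex ?Z" "?Z \<noteq> {}" "compact ?Z" using S by auto
  have Z_ker: "proj x = 0" if "x \<in> (*\<^sub>R) t ` ?Z" for x t
    using that zonotope_subset_span[OF S(1), of w] by (auto simp: ker intro: span_scale)
  have "poly (smult c (subset_poly fB S)) t \<le> poly p t" if t: "0 \<le> t" for t
  proof -
    have "c * vol (cball 0 1 + (*\<^sub>R) t ` ?Z) \<le> vol (K + (*\<^sub>R) (M + t) ` ?Z)"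
    proof (rule slices_compare)
      show "(+) s ` ({x \<in> cball 0 1. proj x = 0} + (*\<^sub>R) t ` ?Z) \<subseteq> (*\<^sub>R) (M + t) ` ?Z"
      proof clarify
        fix x assume "x \<in> {x \<in> cball 0 1. proj x = 0} + (*\<^sub>R) t ` ?Z"
        then obtain y z where yz: "y \<in> cball 0 1 \<inter> ?V" "z \<in> ?Z" "x = y + t *\<^sub>R z"
          by (auto simp: set_plus_def ker)
        have "(s + y) + t *\<^sub>R z \<in> (*\<^sub>R) M ` ?Z + (*\<^sub>R) t ` ?Z"
          using M yz by (intro set_plus_intro) auto
        also have "\<dots> = (*\<^sub>R) (M + t) ` ?Z" using Z M t by (intro scaleR_convex_add) auto
        finally show "s + x \<in> (*\<^sub>R) (M + t) ` ?Z" by (simp add: yz add.assoc)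
      qed
      show "compact ((*\<^sub>R) t ` ?Z)" "compact ((*\<^sub>R) (M + t) ` ?Z)"
        using Z by (auto intro: compact_scaling)
    qed (fact K Z_ker proj[OF i])+
    then show ?thesis using fK[of "M + t"] fB[of t] t M by (simp add: p_def poly_pcompose)
  qed
  then have "coeff (smult c (subset_poly fB S)) (card S) \<le> coeff p (card S)"
    unfolding p_def using S
    by (intro coeff_le_of_poly_le)
       (auto intro: order_trans[OF degree_smult_le] order_trans[OF degree_pcompose_linear_le] degree_subset_poly)
  also have "\<dots> = fK S"
    unfolding p_def using S by (simp add: coeff_pcompose_shift degree_subset_poly lead_coeff_subset_poly)
  finally show ?thesis using S by (simp add: lead_coeff_subset_poly)
qed

text \<open>For dependent generators the complement of the span is too large to match
  \<open>'b\<close>. There growth alone gives \<open>fB S \<le> 0 \<le> fK S\<close>, the latter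
  because volumes are nonnegative.\<close>

lemma coeff_compare:
  fixes w :: "'i \<Rightarrow> 'a::euclidean_space"
  assumes S: "finite S" "card S + DIM('b::euclidean_space) = DIM('a)"
    and K: "compact K" "0 \<le> c"
    and fK: "\<And>t. 0 \<le> t \<Longrightarrow> vol (K + (*\<^sub>R) t ` zonotope S w) = poly (subset_poly fK S) t"
    and fB: "\<And>T t. T \<subseteq> S \<Longrightarrow> 0 \<le> t \<Longrightarrow> vol (cball 0 1 + (*\<^sub>R) t ` zonotope T w) = poly (subset_poly fB T) t"
    and proj: "\<And>i :: 'b \<Rightarrow> 'a. isometric_embedding i \<Longrightarrow>
       c * vol (cball (0::'b) 1) \<le> vol (isometric_embedding.proj i ` K)"
  shows "c * fB S \<le> fK S"
proof (cases "\<exists>j\<in>S. w j \<in> span (w ` (S - {j}))")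
  case True
  then obtain j where "j \<in> S" "w j \<in> span (w ` (S - {j}))" by blast
  then have "fB S \<le> 0" using coeff_dependent_le_0[OF S(1) _ fB] by auto
  moreover have "coeff 0 (card S) \<le> coeff (subset_poly fK S) (card S)"
    using S fK[symmetric] by (intro coeff_le_of_poly_le degree_subset_poly) auto
  then have "0 \<le> fK S" using S by (simp add: lead_coeff_subset_poly)
  moreover have "c * fB S \<le> 0" using K(2) \<open>fB S \<le> 0\<close> by (rule mult_nonneg_nonpos)
  ultimately show ?thesis by linarith
next
  case False
  show ?thesis
  proof (rule coeff_independent_compare[OF S K fK _ proj])
    show "vol (cball 0 1 + (*\<^sub>R) t ` zonotope S w) = poly (subset_poly fB S) t" if "0 \<le> t" for t
      using that by (rule fB[OF subset_refl])
    show "w j \<notin> span (w ` (S - {j}))" if "j \<in> S" for j using False that by blast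
  qed
qed

text \<open>The coefficient of degree \<open>n - k\<close> is the sum of \<open>f S\<close> over the
  sets with \<open>card S = n - k\<close>, so the setwise comparison can be summed and survives the
  limit.\<close>

lemma steiner_compare:
  fixes K :: "'a::euclidean_space set"
  assumes dim: "DIM('b::euclidean_space) \<le> DIM('a)"
    and K: "compact K" "convex K" "K \<noteq> {}" "0 \<le> c"
    and proj: "\<And>i :: 'b \<Rightarrow> 'a. isometric_embedding i \<Longrightarrow>
       c * vol (cball (0::'b) 1) \<le> vol (isometric_embedding.proj i ` K)"
  shows "\<exists>Q. degree Q \<le> DIM('a) \<and> (\<forall>t\<ge>0. vol (K + cball 0 t) = poly Q t) \<and>
     c * (vol (cball (0::'a) 1) * real (DIM('a) choose DIM('b))) \<le> coeff Q (DIM('a) - DIM('b))"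
proof -
  let ?B = "cball (0::'a) 1" and ?d = "DIM('a) - DIM('b)"
  obtain N and w :: "nat \<Rightarrow> nat \<Rightarrow> 'a" where
    lim: "\<And>K t. compact K \<Longrightarrow> convex K \<Longrightarrow> K \<noteq> {} \<Longrightarrow> 0 \<le> t \<Longrightarrow>
     (\<lambda>m. vol (K + (*\<^sub>R) t ` zonotope {..<N m} (w m))) \<longlonglongrightarrow> vol (K + cball 0 t)"
    using zonotope_vol_limit[where 'a = 'a] by blast
  have "\<forall>m. \<exists>f. \<forall>S\<subseteq>{..<N m}. \<forall>t\<ge>0. vol (K + (*\<^sub>R) t ` zonotope S (w m)) = poly (subset_poly f S) t"
    using K by (intro allI vol_plus_zonotope_poly) auto
  then obtain fK where fK: "\<And>m S t. S \<subseteq> {..<N m} \<Longrightarrow> 0 \<le> t \<Longrightarrow>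
      vol (K + (*\<^sub>R) t ` zonotope S (w m)) = poly (subset_poly (fK m) S) t" by metis
  have "\<forall>m. \<exists>f. \<forall>S\<subseteq>{..<N m}. \<forall>t\<ge>0. vol (?B + (*\<^sub>R) t ` zonotope S (w m)) = poly (subset_poly f S) t"
    by (intro allI vol_plus_zonotope_poly) auto
  then obtain fB where fB: "\<And>m S t. S \<subseteq> {..<N m} \<Longrightarrow> 0 \<le> t \<Longrightarrow>
      vol (?B + (*\<^sub>R) t ` zonotope S (w m)) = poly (subset_poly (fB m) S) t" by metis
  have "\<exists>Q. degree Q \<le> DIM('a) \<and> (\<forall>t\<ge>0. poly Q t = vol (K + cball 0 t)) \<and>
      (\<forall>j. (\<lambda>m. coeff (subset_poly (fK m) {..<N m}) j) \<longlonglongrightarrow> coeff Q j)"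
  proof (rule poly_pointwise_limit)
    show "degree (subset_poly (fK m) {..<N m}) \<le> DIM('a)" for m
      using K fK by (intro degree_vol_plus_zonotope_poly[of "{..<N m}" K "w m"]) auto
    show "(\<lambda>m. poly (subset_poly (fK m) {..<N m}) t) \<longlonglongrightarrow> vol (K + cball 0 t)" if "0 \<le> t" for t
      using lim[OF K(1-3) that] that by (simp add: fK)
  qed
  then obtain Q where Q: "degree Q \<le> DIM('a)" "\<And>t. 0 \<le> t \<Longrightarrow> poly Q t = vol (K + cball 0 t)"
      "\<And>j. (\<lambda>m. coeff (subset_poly (fK m) {..<N m}) j) \<longlonglongrightarrow> coeff Q j" by blast
  have "\<exists>R. degree R \<le> DIM('a) \<and> (\<forall>t\<ge>0. poly R t = vol (?B + cball 0 t)) \<and>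
      (\<forall>j. (\<lambda>m. coeff (subset_poly (fB m) {..<N m}) j) \<longlonglongrightarrow> coeff R j)"
  proof (rule poly_pointwise_limit)
    show "degree (subset_poly (fB m) {..<N m}) \<le> DIM('a)" for m
      using fB by (intro degree_vol_plus_zonotope_poly[of "{..<N m}" ?B "w m"]) auto
    show "(\<lambda>m. poly (subset_poly (fB m) {..<N m}) t) \<longlonglongrightarrow> vol (?B + cball 0 t)" if "0 \<le> t" for t
      using lim[of ?B t] that by (simp add: fB)
  qed
  then obtain R where R: "degree R \<le> DIM('a)" "\<And>t. 0 \<le> t \<Longrightarrow> poly R t = vol (?B + cball 0 t)"
      "\<And>j. (\<lambda>m. coeff (subset_poly (fB m) {..<N m}) j) \<longlonglongrightarrow> coeff R j" by blast
  \<comment> \<open>The sum of two balls is a ball of radius \<open>1 + t\<close>; agreement at the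
    \<open>n + 1\<close> nodes identifies the limit polynomial of the ball.\<close>
  define R' where "R' = smult (vol ?B) ([:1, 1:] ^ DIM('a))"
  have "coeff R ?d = coeff R' ?d"
  proof -
    have "poly R t = poly R' t" if "0 \<le> t" for t
      using that vol_cball_0[of "1 + t", where 'a = 'a]
      by (simp add: R cball_0_plus R'_def ball_poly(1) mult.commute)
    then have "R = R'"
      using R(1) ball_poly(2)[of "vol ?B" 1 1 "DIM('a)"]
      by (intro poly_eqI_degree[of "real ` {..DIM('a)}"]) (auto simp: card_image R'_def)
    then show ?thesis by simp
  qed
  also have "\<dots> = vol ?B * real (DIM('a) choose DIM('b))"
    unfolding R'_def using dim binomial_symmetric[OF dim] by (subst ball_poly(3)) auto
  finally have cR: "coeff R ?d = vol ?B * real (DIM('a) choose DIM('b))" .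
  have "c * coeff R ?d \<le> coeff Q ?d"
  proof (rule LIMSEQ_le)
    show "(\<lambda>m. c * coeff (subset_poly (fB m) {..<N m}) ?d) \<longlonglongrightarrow> c * coeff R ?d"
      by (intro tendsto_intros R)
    show "(\<lambda>m. coeff (subset_poly (fK m) {..<N m}) ?d) \<longlonglongrightarrow> coeff Q ?d" by (rule Q)
    have "c * coeff (subset_poly (fB m) {..<N m}) ?d \<le> coeff (subset_poly (fK m) {..<N m}) ?d" for m
      unfolding coeff_subset_poly[OF finite_lessThan] sum_distrib_left
    proof (rule sum_mono)
      fix S assume S: "S \<in> {T. T \<subseteq> {..<N m} \<and> card T = ?d}"
      then have "finite S" using finite_subset by blast
      then show "c * fB m S \<le> fK m S"
      proof (rule coeff_compare[where 'b = 'b and w = "w m"])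
        show "card S + DIM('b) = DIM('a)" using S dim by simp
        show "vol (cball 0 1 + (*\<^sub>R) t ` zonotope T (w m)) = poly (subset_poly (fB m) T) t"
          if "T \<subseteq> S" "0 \<le> t" for T t using that S by (intro fB) auto
        show "vol (K + (*\<^sub>R) t ` zonotope S (w m)) = poly (subset_poly (fK m) S) t"
          if "0 \<le> t" for t using that S by (intro fK) auto
      qed (use K proj in auto)
    qed
    then show "\<exists>N'. \<forall>m\<ge>N'. c * coeff (subset_poly (fB m) {..<N m}) ?d \<le> coeff (subset_poly (fK m) {..<N m}) ?d"
      by blast
  qed
  then show ?thesis using Q(1,2) cR by (intro exI[of _ Q] conjI allI impI) simp_all
qed

section \<open>Quermassintegrals\<close>

text \<open>The multinomial sum of \<open>mixed_coeffs\<close> when only two distinct bodies occur.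
  Prepending an index with \<open>P\<close> shifts \<open>h\<close> by one, hence \<open>h\<close>
  is arbitrary in the induction; the two cases recombine by Pascal's rule.\<close>

lemma sum_lists_by_count:
  fixes t :: "'i \<Rightarrow> real" and h :: "nat \<Rightarrow> real" and P :: "'i \<Rightarrow> bool"
  assumes "finite A"
  defines "a \<equiv> \<Sum>i | i \<in> A \<and> \<not> P i. t i" and "b \<equiv> \<Sum>i | i \<in> A \<and> P i. t i"
  shows "(\<Sum>is | set is \<subseteq> A \<and> length is = m. h (length (filter P is)) * (\<Prod>i\<leftarrow>is. t i)) =
    (\<Sum>j\<le>m. real (m choose j) * h j * a ^ (m - j) * b ^ j)"
proof (induction m arbitrary: h)
  case 0
  have "{is. set is \<subseteq> A \<and> length is = 0} = {[]}" by auto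
  then show ?case by simp
next
  case (Suc m)
  let ?L = "\<lambda>m. {is. set is \<subseteq> A \<and> length is = m}"
  let ?F = "\<lambda>m h. \<Sum>j\<le>m. real (m choose j) * h j * a ^ (m - j) * b ^ j"
  let ?g = "\<lambda>is. h (length (filter P is)) * (\<Prod>i\<leftarrow>is. t i)"
  let ?G = "\<lambda>is. h (Suc (length (filter P is))) * (\<Prod>i\<leftarrow>is. t i)"
  have "?L (Suc m) = (\<lambda>(x, is). x # is) ` (A \<times> ?L m)"
    by (auto simp: length_Suc_conv image_iff)
  then have "(\<Sum>is\<in>?L (Suc m). ?g is) = (\<Sum>(x, is)\<in>A \<times> ?L m. ?g (x # is))"
    by (simp add: sum.reindex inj_on_def case_prod_unfold)
  also have "\<dots> = (\<Sum>x\<in>A. \<Sum>is\<in>?L m. ?g (x # is))"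
    by (simp add: sum.cartesian_product)
  also have "\<dots> = (\<Sum>x\<in>A. t x * (if P x then \<Sum>is\<in>?L m. ?G is else \<Sum>is\<in>?L m. ?g is))"
    by (intro sum.cong refl) (simp add: sum_distrib_left mult.left_commute)
  also have "\<dots> = (\<Sum>x\<in>A. t x * (if P x then ?F m (\<lambda>j. h (Suc j)) else ?F m h))"
    by (simp only: Suc.IH[of h] Suc.IH[of "\<lambda>j. h (Suc j)"])
  also have "\<dots> = (\<Sum>x\<in>A. if P x then t x * ?F m (\<lambda>j. h (Suc j)) else 0)
       + (\<Sum>x\<in>A. if \<not> P x then t x * ?F m h else 0)"
    unfolding sum.distrib[symmetric] by (intro sum.cong refl) auto
  also have "(\<Sum>x\<in>A. if P x then t x * ?F m (\<lambda>j. h (Suc j)) else 0) = b * ?F m (\<lambda>j. h (Suc j))"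
    unfolding b_def sum_distrib_right using assms(1) by (subst sum.inter_filter[symmetric]) auto
  also have "(\<Sum>x\<in>A. if \<not> P x then t x * ?F m h else 0) = a * ?F m h"
    unfolding a_def sum_distrib_right using assms(1) by (subst sum.inter_filter[symmetric]) auto
  also have "a * ?F m h = (\<Sum>j\<le>m. real (m choose j) * h j * a ^ (Suc m - j) * b ^ j)"
    unfolding sum_distrib_left by (intro sum.cong refl) (simp add: Suc_diff_le mult_ac)
  also have "\<dots> = (\<Sum>j\<le>Suc m. real (m choose j) * h j * a ^ (Suc m - j) * b ^ j)"
    by (simp add: binomial_eq_0)
  also have "\<dots> = h 0 * a ^ Suc m + (\<Sum>j\<le>m. real (m choose Suc j) * h (Suc j) * a ^ (m - j) * b ^ Suc j)"
    by (subst sum.atMost_Suc_shift) simp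
  also have "b * ?F m (\<lambda>j. h (Suc j)) + (h 0 * a ^ Suc m + (\<Sum>j\<le>m. real (m choose Suc j) * h (Suc j) * a ^ (m - j) * b ^ Suc j))
    = h 0 * a ^ Suc m + (\<Sum>j\<le>m. real (Suc m choose Suc j) * h (Suc j) * a ^ (m - j) * b ^ Suc j)"
    by (simp add: sum_distrib_left sum.distrib algebra_simps)
  also have "\<dots> = ?F (Suc m) h" by (subst sum.atMost_Suc_shift) simp
  finally show ?case .
qed

text \<open>For large \<open>t\<close> the sum is squeezed between a translate of the ball of radius
  \<open>t\<close> and the ball of radius \<open>R + t\<close>. This settles the degenerate
  expansion in which \<open>K\<close> has weight 0 and homogeneity gives nothing.\<close>

lemma coeff_DIM_steiner:
  fixes K :: "'a::euclidean_space set"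
  assumes K: "compact K" "K \<noteq> {}" and Q: "degree Q \<le> DIM('a)" "\<And>t. 0 \<le> t \<Longrightarrow> vol (K + cball 0 t) = poly Q t"
  shows "coeff Q DIM('a) = vol (cball (0::'a) 1)"
proof (rule antisym)
  let ?\<kappa> = "vol (cball (0::'a) 1)"
  obtain R where R: "R > 0" "K \<subseteq> cball 0 R"
    using compact_imp_bounded[OF K(1)] by (auto simp: bounded_pos subset_iff)
  obtain p where p: "p \<in> K" using K by blast
  have "coeff Q DIM('a) \<le> coeff (smult ?\<kappa> ([:R, 1:] ^ DIM('a))) DIM('a)"
  proof (rule coeff_le_of_poly_le)
    fix t :: real assume t: "0 \<le> t"
    have "K + cball 0 t \<subseteq> cball 0 R + cball 0 t" using R by (intro set_plus_mono2) auto
    also have "\<dots> = cball 0 (R + t)" using R t by (simp add: cball_0_plus)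
    finally have "vol (K + cball 0 t) \<le> vol (cball (0::'a) (R + t))"
      using K by (intro vol_mono compact_set_plus) auto
    then show "poly Q t \<le> poly (smult ?\<kappa> ([:R, 1:] ^ DIM('a))) t"
      using Q(2)[OF t] R t vol_cball_0[of "R + t", where 'a = 'a] by (simp add: ball_poly(1) mult.commute)
  qed (rule ball_poly(2) Q(1))+
  then show "coeff Q DIM('a) \<le> ?\<kappa>" by (simp add: ball_poly(3) del: coeff_smult)
  have "coeff (smult ?\<kappa> ([:0, 1:] ^ DIM('a))) DIM('a) \<le> coeff Q DIM('a)"
  proof (rule coeff_le_of_poly_le)
    fix t :: real assume t: "0 \<le> t"
    have "vol (cball (0::'a) t) \<le> vol (K + cball 0 t)"
    proof (rule vol_translate_mono)
      show "(+) p ` cball 0 t \<subseteq> K + cball 0 t" by (intro image_subsetI set_plus_intro p)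
    qed (use K in \<open>auto intro: compact_set_plus\<close>)
    then show "poly (smult ?\<kappa> ([:0, 1:] ^ DIM('a))) t \<le> poly Q t"
      using Q(2)[OF t] t vol_cball_0[of t, where 'a = 'a] by (simp add: ball_poly(1) mult.commute)
  qed (rule ball_poly(2) Q(1))+
  then show "?\<kappa> \<le> coeff Q DIM('a)" by (simp add: ball_poly(3) del: coeff_smult)
qed

text \<open>For positive \<open>a\<close>, homogeneity reduces the volume of
  \<open>a K + b B\<close> to \<open>Q\<close> at \<open>b / a\<close>. Dividing by the binomial
  coefficient spreads a Steiner coefficient evenly over the positions at which the ball can
  occur.\<close>

lemma quermassintegral_eq_coeff:
  fixes K :: "'a::euclidean_space set"
  assumes K: "compact K" "convex K" "K \<noteq> {}" and j: "j \<le> DIM('a)"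
    and Q: "degree Q \<le> DIM('a)" "\<And>t. 0 \<le> t \<Longrightarrow> vol (K + cball 0 t) = poly Q t"
  shows "quermassintegral j K = coeff Q j / real (DIM('a) choose j)"
proof -
  let ?n = "DIM('a)" and ?B = "cball (0::'a) 1"
  define k where "k = ?n - j"
  have k: "k \<le> ?n" "?n - k = j" using j by (auto simp: k_def)
  define h where "h l = coeff Q l / real (?n choose l)" for l
  \<comment> \<open>Indices below \<open>k\<close> refer to \<open>K\<close> and those from
    \<open>k\<close> on to the ball; depending only on their number makes \<open>c\<close>
    symmetric.\<close>
  define c where "c is = h (length (filter (\<lambda>i. k \<le> i) is))" for "is" :: "nat list"
  let ?Ks = "replicate k K @ replicate j ?B"
  have "mixed_coeffs ?Ks c"
    unfolding mixed_coeffs_def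
  proof (intro conjI allI impI)
    fix "is" js :: "nat list" assume "mset is = mset js"
    then have "length (filter (\<lambda>i. k \<le> i) is) = length (filter (\<lambda>i. k \<le> i) js)"
      by (metis mset_filter size_mset)
    then show "c is = c js" by (simp add: c_def)
  next
    fix t :: "nat \<Rightarrow> real" assume t: "\<forall>i. 0 \<le> t i"
    define a b where "a = (\<Sum>i<k. t i)" and "b = (\<Sum>i\<in>{k..<?n}. t i)"
    have ab: "0 \<le> a" "0 \<le> b" using t by (auto simp: a_def b_def sum_nonneg)
    have "(\<Sum>i<?n. (*\<^sub>R) (t i) ` (?Ks ! i)) =
      (\<Sum>i<k. (*\<^sub>R) (t i) ` (?Ks ! i)) + (\<Sum>i\<in>{k..<?n}. (*\<^sub>R) (t i) ` (?Ks ! i))"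
    proof -
      have split: "{..<?n} = {..<k} \<union> {k..<?n}" using k by auto
      show ?thesis unfolding split by (rule sum.union_disjoint) auto
    qed
    also have "(\<Sum>i<k. (*\<^sub>R) (t i) ` (?Ks ! i)) = (\<Sum>i<k. (*\<^sub>R) (t i) ` K)"
      by (intro sum.cong) (auto simp: nth_append)
    also have "\<dots> = (*\<^sub>R) a ` K"
      unfolding a_def using K t by (intro sum_scaled_convex) auto
    also have "(\<Sum>i\<in>{k..<?n}. (*\<^sub>R) (t i) ` (?Ks ! i)) = (\<Sum>i\<in>{k..<?n}. (*\<^sub>R) (t i) ` ?B)"
      using k by (intro sum.cong) (auto simp: nth_append)
    also have "\<dots> = (*\<^sub>R) b ` ?B"
      unfolding b_def using t by (intro sum_scaled_convex) auto
    also have "\<dots> = cball 0 b" using ab by (simp add: scaleR_cball_0)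
    also have "vol ((*\<^sub>R) a ` K + cball 0 b) = (\<Sum>l\<le>?n. coeff Q l * a ^ (?n - l) * b ^ l)"
    proof (cases "a = 0")
      case True
      have "(*\<^sub>R) a ` K = {0}" using True K by auto
      then have "vol ((*\<^sub>R) a ` K + cball 0 b) = coeff Q ?n * b ^ ?n"
        using vol_cball_0[OF ab(2), where 'a = 'a] coeff_DIM_steiner[OF K(1,3) Q] by simp
      also have "\<dots> = (\<Sum>l\<le>?n. if l = ?n then coeff Q l * b ^ l else 0)" by simp
      also have "\<dots> = (\<Sum>l\<le>?n. coeff Q l * a ^ (?n - l) * b ^ l)"
        using True by (intro sum.cong) auto
      finally show ?thesis .
    next
      case False
      then have a: "a > 0" using ab by simp
      have "(*\<^sub>R) a ` K + cball 0 b = (*\<^sub>R) a ` (K + cball 0 (b / a))"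
        using a ab by (simp add: scaleR_image_plus scaleR_cball_0)
      then have "vol ((*\<^sub>R) a ` K + cball 0 b) = a ^ ?n * poly Q (b / a)"
        using a ab Q(2)[of "b / a"] by (simp add: vol_scaleR)
      also have "poly Q (b / a) = (\<Sum>l\<le>?n. coeff Q l * (b / a) ^ l)"
        unfolding poly_altdef using Q(1) by (intro sum.mono_neutral_left) (auto simp: coeff_eq_0)
      also have "a ^ ?n * \<dots> = (\<Sum>l\<le>?n. coeff Q l * a ^ (?n - l) * b ^ l)"
        unfolding sum_distrib_left using a by (intro sum.cong) (auto simp: power_divide power_diff field_simps)
      finally show ?thesis .
    qed
    also have "\<dots> = (\<Sum>l\<le>?n. real (?n choose l) * h l * a ^ (?n - l) * b ^ l)"
      by (intro sum.cong) (auto simp: h_def)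
    also have "\<dots> = (\<Sum>is | set is \<subseteq> {..<?n} \<and> length is = ?n. c is * (\<Prod>i\<leftarrow>is. t i))"
    proof -
      have "{i. i \<in> {..<?n} \<and> \<not> k \<le> i} = {..<k}" "{i. i \<in> {..<?n} \<and> k \<le> i} = {k..<?n}"
        using k by auto
      then show ?thesis
        using sum_lists_by_count[of "{..<?n}" h "\<lambda>i. k \<le> i" t ?n] by (simp add: c_def a_def b_def)
    qed
    finally show "vol (\<Sum>i<?n. (*\<^sub>R) (t i) ` (?Ks ! i)) =
      (\<Sum>is | set is \<subseteq> {..<?n} \<and> length is = ?n. c is * (\<Prod>i\<leftarrow>is. t i))" .
  qed
  then have "quermassintegral j K = c [0..<?n]"
    unfolding quermassintegral_def k_def[symmetric] by (rule mixed_volume_eqI)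
  also have "filter (\<lambda>i. k \<le> i) [0..<?n] = [k..<?n]"
  proof -
    have "[0..<?n] = [0..<k] @ [k..<?n]" using upt_add_eq_append[of 0 k j] j by (simp add: k_def)
    then show ?thesis by (simp add: filter_empty_conv filter_id_conv)
  qed
  then have "c [0..<?n] = h j" using k by (simp add: c_def)
  finally show ?thesis by (simp add: h_def)
qed

lemma quermassintegral_cball:
  assumes "0 \<le> r" "j \<le> DIM('a::euclidean_space)"
  shows "quermassintegral j (cball (0::'a) r) = vol (cball (0::'a) 1) * r ^ (DIM('a) - j)"
proof -
  let ?Q = "smult (vol (cball (0::'a) 1)) ([:r, 1:] ^ DIM('a))"
  have "quermassintegral j (cball (0::'a) r) = coeff ?Q j / real (DIM('a) choose j)"
  proof (rule quermassintegral_eq_coeff)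
    show "vol (cball (0::'a) r + cball 0 t) = poly ?Q t" if "0 \<le> t" for t
      using assms that vol_cball_0[of "r + t", where 'a = 'a]
      by (simp add: cball_0_plus ball_poly(1) mult.commute)
  qed (use assms in \<open>auto simp del: degree_smult_eq intro: ball_poly(2)\<close>)
  also have "\<dots> = vol (cball (0::'a) 1) * r ^ (DIM('a) - j)"
    using assms(2) by (subst ball_poly(3)) auto
  finally show ?thesis .
qed

section \<open>Bodies of constant width: symmetrization and projections\<close>

lemma supp_fun_upper:
  assumes "compact K" "x \<in> K"
  shows "x \<bullet> u \<le> supp_fun K u"
  unfolding supp_fun_def using assms
  by (intro cSUP_upper bounded_imp_bdd_above compact_imp_bounded compact_continuous_image)
     (auto intro!: continuous_intros)

lemma supp_fun_attained:
  assumes "compact K" "K \<noteq> {}"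
  shows "\<exists>x\<in>K. supp_fun K u = x \<bullet> u"
proof -
  obtain x where x: "x \<in> K" "\<And>y. y \<in> K \<Longrightarrow> y \<bullet> u \<le> x \<bullet> u"
    using continuous_attains_sup[OF assms continuous_on_inner[OF continuous_on_id continuous_on_const], of u]
    by blast
  have "supp_fun K u = x \<bullet> u"
    unfolding supp_fun_def using x by (intro cSup_eq_maximum) auto
  then show ?thesis using x by blast
qed

text \<open>In a unit direction the support function of the symmetrization is half the width, hence
  \<open>r\<close>, exactly as for the ball.\<close>

lemma central_sym_constant_width:
  fixes K :: "'a::euclidean_space set"
  assumes K: "compact K" "convex K" "K \<noteq> {}" and w: "constant_width K (2 * r)"
  shows "central_sym K = cball 0 r"
proof
  have mem: "(1/2) *\<^sub>R (x - y) \<in> central_sym K" if "x \<in> K" "y \<in> K" for x y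
    using that set_plus_intro[of x K "- y" "uminus ` K"] by (auto simp: central_sym_def)
  have r: "supp_fun K u + supp_fun K (- u) = 2 * r" if "norm u = 1" for u
    using w that by (simp add: constant_width_def)
  have cneg: "compact (uminus ` K)" "convex (uminus ` K)"
    using compact_scaling[OF K(1), of "-1"] convex_scaling[OF K(2), of "-1"] by simp_all
  show "central_sym K \<subseteq> cball 0 r"
  proof
    fix z assume "z \<in> central_sym K"
    then obtain x y where xy: "x \<in> K" "y \<in> K" "z = (1/2) *\<^sub>R (x - y)"
      by (auto simp: central_sym_def set_plus_def)
    have le: "z \<bullet> u \<le> r" if "norm u = 1" for u
      using supp_fun_upper[OF K(1) xy(1), of u] supp_fun_upper[OF K(1) xy(2), of "- u"] r[OF that]
      by (simp add: xy(3) inner_diff_left)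
    show "z \<in> cball 0 r"
    proof (cases "z = 0")
      \<comment> \<open>Nothing is assumed about the sign of \<open>r\<close>; any unit direction
        yields \<open>0 \<le> r\<close>.\<close>
      case True
      obtain u :: 'a where "norm u = 1" using vector_choose_size[of 1] by auto
      then show ?thesis using le[of u] True by simp
    next
      case False
      then have "norm z = z \<bullet> (z /\<^sub>R norm z)" by (simp add: dot_square_norm power2_eq_square)
      then show ?thesis using le[of "z /\<^sub>R norm z"] False by simp
    qed
  qed
  show "cball 0 r \<subseteq> central_sym K"
  proof (rule subset_if_supports_le)
    show "convex (central_sym K)" "closed (central_sym K)"
      unfolding central_sym_def using K cneg
      by (auto intro!: convex_scaling convex_set_plus compact_imp_closed compact_scaling compact_set_plus)
    show "central_sym K \<noteq> {}" using mem K(3) by blast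
    fix v u :: 'a assume v: "v \<in> cball 0 r" and u: "norm u = 1"
    obtain x where x: "x \<in> K" "supp_fun K u = x \<bullet> u" using supp_fun_attained[OF K(1,3)] by blast
    obtain y where y: "y \<in> K" "supp_fun K (- u) = y \<bullet> (- u)" using supp_fun_attained[OF K(1,3)] by blast
    have "v \<bullet> u \<le> r" using norm_cauchy_schwarz[of v u] u v by simp
    also have "r = ((1/2) *\<^sub>R (x - y)) \<bullet> u" using r[OF u] x y by (simp add: inner_diff_left)
    finally show "\<exists>z\<in>central_sym K. v \<bullet> u \<le> z \<bullet> u" using mem x y by blast
  qed
qed

context isometric_embedding
begin

lemma convex_body_proj:
  assumes "convex_body K"
  shows "convex_body (proj ` K)"
proof -
  have "surj proj" by (rule surjI[of proj i]) simp
  then have "open (proj ` interior K)"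
    by (intro open_surjective_linear_image linear_proj) auto
  then have "proj ` interior K \<subseteq> interior (proj ` K)"
    using interior_subset[of K] by (intro interior_maximal) auto
  then show ?thesis
    using assms compact_proj convex_linear_image[OF linear_proj] by (auto simp: convex_body_def)
qed

text \<open>By adjointness the support function of the projection is that of \<open>K\<close>
  composed with \<open>i\<close>, which preserves unit vectors.\<close>

lemma constant_width_proj:
  assumes "constant_width K w"
  shows "constant_width (proj ` K) w"
proof -
  have "supp_fun (proj ` K) u = supp_fun K (i u)" for u
    by (simp add: supp_fun_def image_image inner_proj)
  then show ?thesis
    using assms by (simp add: constant_width_def norm_i linear_neg[OF linear_i])
qed

end

theorem theorem4p4:
  fixes K :: "(real ^ 'n) set" and r \<mu> :: real
  assumes "2 \<le> CARD('k::finite)" and "CARD('k) \<le> CARD('n::finite)" and "0 < r"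
    and "0 < \<mu>" and "\<mu> \<le> 1"
    and "\<And>L :: (real ^ 'k) set. convex_body L \<Longrightarrow> constant_width L (2 * r) \<Longrightarrow>
           measure lebesgue L \<ge> \<mu> * measure lebesgue (cball 0 1 :: (real ^ 'k) set) * r ^ CARD('k)"
    and "convex_body K" and "constant_width K (2 * r)"
  shows "asym_defect CARD('k) K
           \<le> measure lebesgue (cball 0 1 :: (real ^ 'n) set) * (1 - \<mu>) * r ^ CARD('k)"
proof -
  let ?k = "CARD('k)" and ?n = "CARD('n)" and ?\<kappa> = "vol (cball 0 1 :: (real ^ 'n) set)"
  \<comment> \<open>The radius is absorbed into the constant because the reference body is the unit
    ball.\<close>
  let ?c = "\<mu> * r ^ ?k"
  have K: "compact K" "convex K" "K \<noteq> {}"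
    using assms(7) interior_subset[of K] by (auto simp: convex_body_def)
  have "?c * vol (cball 0 1 :: (real ^ 'k) set) \<le> vol (isometric_embedding.proj i ` K)"
    if "isometric_embedding i" for i :: "real ^ 'k \<Rightarrow> real ^ 'n"
  proof -
    interpret isometric_embedding i by fact
    show ?thesis
      using assms(6)[OF convex_body_proj[OF assms(7)] constant_width_proj[OF assms(8)]]
      by (simp add: mult_ac)
  qed
  then obtain Q where Q: "degree Q \<le> ?n" "\<And>t. 0 \<le> t \<Longrightarrow> vol (K + cball 0 t) = poly Q t"
    "?c * (?\<kappa> * real (?n choose ?k)) \<le> coeff Q (?n - ?k)"
    using steiner_compare[where 'b = "real ^ 'k", OF _ K, of ?c] assms(2-4) by auto
  have W_K: "quermassintegral (?n - ?k) K = coeff Q (?n - ?k) / real (?n choose ?k)"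
    using quermassintegral_eq_coeff[OF K, of "?n - ?k" Q] Q binomial_symmetric[OF assms(2)] by simp
  have "?n choose ?k > 0" using assms(2) by simp
  then have "?c * ?\<kappa> \<le> quermassintegral (?n - ?k) K"
    using Q(3) by (simp add: W_K pos_le_divide_eq mult.assoc)
  moreover have "quermassintegral (?n - ?k) (central_sym K) = ?\<kappa> * r ^ ?k"
    unfolding central_sym_constant_width[OF K assms(8)]
    using quermassintegral_cball[of r "?n - ?k", where 'a = "real ^ 'n"] assms(2,3) by simp
  ultimately show ?thesis
    by (simp add: asym_defect_def algebra_simps)
qed

end
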